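(* Let $n\ge 3$, let $a_1,\dots,a_n$ be nonzero real numbers, and let $f:[0,1]^n\to\mathbb{R}$, $f(\boldsymbol{x})=\sum_{i=1}^n a_ix_ix_{i+1}$ (indices modulo $n$), be the bilinear function whose graph is the $n$-cycle $C_n$. Put $$E^-=\{i\in[n]: a_i<0\},\quad E^+=\{i\in[n]: a_i>0\},$$ $$V^-=\{i\in[n]:\{i-1,i\}\subseteq E^-\},\quad V^+=\{i\in[n]:\{i-1,i\}\subseteq E^+\}.$$ Let $P\subseteq[0,1]^{2n}$ be the polytope of all $(\boldsymbol{x},\boldsymbol{y})=(x_1,\dots,x_n,y_1,\dots,y_n)$ described by the McCormick inequalities $$y_i\ge 0,\quad y_i\le x_i,\quad y_i\le x_{i+1},\quad x_i+x_{i+1}-y_i\le 1\qquad (i\in[n])$$ and $$\text{(A)}\quad x(V^-)-x(V^+)+y(E^+)-y(E^-)\le\left\lfloor\frac{|E^-|}{2}\right\rfloor,$$ $$\text{(B)}\quad x(V^+)-x(V^-)+y(E^-)-y(E^+)\le\left\lfloor\frac{|E^+|}{2}\right\rfloor.$$ Then $\pi[f](P)=X(f)$. Moreover, inequality (A) (respectively (B)) can be omitted (without destroying this equality) if and only if $|E^-|$ (respectively $|E^+|$) is even, and then (i.e. after these omissions) $P$ is a minimal extension of $X(f)$.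
   Context: All indices are in $[n]=\{1,\dots,n\}$ and are read modulo $n$ ($0\equiv n$, $n+1\equiv 1$). The edge $\{i,i+1\}$ of the cycle is referred to as edge $i$; $y_i$ stands for the variable $y_{i,i+1}$ representing the product $x_ix_{i+1}$. For $S\subseteq[n]$, $x(S)=\sum_{i\in S}x_i$ and $y(S)=\sum_{i\in S}y_i$. $X(f)=\operatorname{conv}\{(\boldsymbol{x},z)\in[0,1]^n\times\mathbb{R}: z=f(\boldsymbol{x})\}$. The map $\pi[f]:\mathbb{R}^{2n}\to\mathbb{R}^{n+1}$ is $\pi[f](\boldsymbol{x},\boldsymbol{y})=(\boldsymbol{x},\sum_{i=1}^n a_iy_i)$, and $\pi[f](P)$ denotes the image of $P$. $QP(C_n)=\operatorname{conv}\{(\boldsymbol{x},\boldsymbol{y})\in\{0,1\}^{2n}: y_i=x_ix_{i+1}\text{ for all }i\in[n]\}$. A polytope $P\supseteq QP(C_n)$ with $\pi[f](P)=X(f)$ is called an extended formulation (extension) of $X(f)$; it is minimal if omitting any facet-defining inequality of $P$ leads to a polytope $P'\supsetneq P$ with $\pi[f](P')\supsetneq X(f)$. *)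

theory Defs
  imports
    "HOL-Analysis.Analysis"
    "Berlekamp_Zassenhaus.Finite_Field"
begin

text \<open>
  The index set \<open>[n]\<close>, read modulo \<open>n\<close>, is the type \<open>'k mod_ring\<close> of integers modulo
  \<open>n = CARD('k)\<close>; thus \<open>i + 1\<close> and \<open>i - 1\<close> are the cyclic neighbours of \<open>i\<close>.
  An index \<open>i\<close> names both the vertex \<open>i\<close> and the edge \<open>{i, i + 1}\<close>, so that the edges at
  the vertex \<open>i\<close> are \<open>i - 1\<close> and \<open>i\<close>.
\<close>

type_synonym 'k idx_vec = "real ^ ('k mod_ring)"
type_synonym 'k xz_space = "'k idx_vec \<times> real"
type_synonym 'k xy_space = "'k idx_vec \<times> 'k idx_vec"

definition cycle_fun :: "('k::nontriv mod_ring \<Rightarrow> real) \<Rightarrow> 'k idx_vec \<Rightarrow> real" where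
  "cycle_fun a x = (\<Sum>i\<in>UNIV. a i * (x $ i) * (x $ (i + 1)))"

definition graph_hull :: "('k::nontriv idx_vec \<Rightarrow> real) \<Rightarrow> 'k xz_space set" where
  "graph_hull f = convex hull {(x, z). (\<forall>i. x $ i \<in> {0..1}) \<and> z = f x}"

definition lift_proj :: "('k::nontriv mod_ring \<Rightarrow> real) \<Rightarrow> 'k xy_space \<Rightarrow> 'k xz_space" where
  "lift_proj a = (\<lambda>(x, y). (x, \<Sum>i\<in>UNIV. a i * (y $ i)))"

definition QP_cycle :: "'k::nontriv xy_space set" where
  "QP_cycle = convex hull
     {(x, y). (\<forall>i. x $ i \<in> {0, 1}) \<and> (\<forall>i. y $ i \<in> {0, 1}) \<and>
              (\<forall>i. y $ i = (x $ i) * (x $ (i + 1)))}"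

definition E_neg :: "('k::nontriv mod_ring \<Rightarrow> real) \<Rightarrow> 'k mod_ring set" where
  "E_neg a = {i. a i < 0}"

definition E_pos :: "('k::nontriv mod_ring \<Rightarrow> real) \<Rightarrow> 'k mod_ring set" where
  "E_pos a = {i. a i > 0}"

definition V_neg :: "('k::nontriv mod_ring \<Rightarrow> real) \<Rightarrow> 'k mod_ring set" where
  "V_neg a = {i. {i - 1, i} \<subseteq> E_neg a}"

definition V_pos :: "('k::nontriv mod_ring \<Rightarrow> real) \<Rightarrow> 'k mod_ring set" where
  "V_pos a = {i. {i - 1, i} \<subseteq> E_pos a}"

definition McCormick :: "'k::nontriv xy_space set" where
  "McCormick = {(x, y). \<forall>i. 0 \<le> y $ i \<and> y $ i \<le> x $ i \<and> y $ i \<le> x $ (i + 1) \<and>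
                             x $ i + x $ (i + 1) - y $ i \<le> 1}"

lemma McCormick_subset_unit_box:
  assumes "(x, y) \<in> McCormick"
  shows "x $ i \<in> {0..1}" "y $ i \<in> {0..1}"
proof -
  have "0 \<le> y $ i" "y $ i \<le> x $ i" "y $ i \<le> x $ (i + 1)" "x $ i + x $ (i + 1) - y $ i \<le> 1"
    using assms by (auto simp: McCormick_def)
  then show "x $ i \<in> {0..1}" "y $ i \<in> {0..1}"
    by auto
qed

definition halfspace_A :: "('k::nontriv mod_ring \<Rightarrow> real) \<Rightarrow> 'k xy_space set" where
  "halfspace_A a = {(x, y).
     (\<Sum>i\<in>V_neg a. x $ i) - (\<Sum>i\<in>V_pos a. x $ i) + (\<Sum>i\<in>E_pos a. y $ i) - (\<Sum>i\<in>E_neg a. y $ i)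
       \<le> of_int \<lfloor>real (card (E_neg a)) / 2\<rfloor>}"

definition halfspace_B :: "('k::nontriv mod_ring \<Rightarrow> real) \<Rightarrow> 'k xy_space set" where
  "halfspace_B a = {(x, y).
     (\<Sum>i\<in>V_pos a. x $ i) - (\<Sum>i\<in>V_neg a. x $ i) + (\<Sum>i\<in>E_neg a. y $ i) - (\<Sum>i\<in>E_pos a. y $ i)
       \<le> of_int \<lfloor>real (card (E_pos a)) / 2\<rfloor>}"

definition facet_defining :: "'v::euclidean_space set \<Rightarrow> 'v \<Rightarrow> real \<Rightarrow> bool" where
  "facet_defining P c d \<longleftrightarrow>
     P \<subseteq> {v. c \<bullet> v \<le> d} \<and> (P \<inter> {v. c \<bullet> v = d}) facet_of P"

text \<open>
  A polytope is cut out of its affine hull by its facet-defining inequalities. Two of these that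
  define the same facet are equivalent on the affine hull, so omitting one of them means omitting
  all the inequalities that define its facet.
\<close>

definition omit_facet :: "'v::euclidean_space set \<Rightarrow> 'v \<Rightarrow> real \<Rightarrow> 'v set" where
  "omit_facet P c d = {v \<in> affine hull P. \<forall>c' d'.
     facet_defining P c' d' \<and> P \<inter> {w. c' \<bullet> w = d'} \<noteq> P \<inter> {w. c \<bullet> w = d} \<longrightarrow> c' \<bullet> v \<le> d'}"

definition extension :: "('k::nontriv mod_ring \<Rightarrow> real) \<Rightarrow> 'k xy_space set \<Rightarrow> bool" where
  "extension a P \<longleftrightarrow>
     polytope P \<and> QP_cycle \<subseteq> P \<and> lift_proj a ` P = graph_hull (cycle_fun a)"

definition minimal_extension :: "('k::nontriv mod_ring \<Rightarrow> real) \<Rightarrow> 'k xy_space set \<Rightarrow> bool" where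
  "minimal_extension a P \<longleftrightarrow> extension a P \<and>
     (\<forall>c d. facet_defining P c d \<longrightarrow>
        polytope (omit_facet P c d) \<and> P \<subset> omit_facet P c d \<and>
        graph_hull (cycle_fun a) \<subset> lift_proj a ` omit_facet P c d)"

end

theory Submission
  imports Defs
begin

text \<open>
  Inequality (A) is the odd cycle inequality of the edge set \<open>E\<^sup>-\<close> (and it follows from the
  McCormick inequalities if this set is even). If it is tight at a point \<open>v\<close>, then \<open>v\<close> is an
  explicit convex combination of the vertices of \<open>QP(C\<^sub>n)\<close> that mismatch exactly one edge. If it is
  not tight at an extreme point of the polytope given by (A) and the McCormick inequalities, then
  \<open>x\<close> is integral or constantly \<open>1/2\<close>: otherwise the coordinates with a common value of
  \<open>\<bar>x i - 1/2\<bar>\<close> can be perturbed. In the half-integral case the objective does not decrease on moving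
  towards the pointwise maximiser of \<open>a i * y i\<close> until (A) is tight, or all the way if \<open>E\<^sup>-\<close> is
  even. Hence the maximum of \<open>z\<close> over each fibre of the projection is attained in \<open>QP(C\<^sub>n)\<close>; the
  minimum follows by replacing \<open>a\<close> with \<open>-a\<close>, which swaps (A) and (B).

  For minimality, each inequality is violated by a point that satisfies all the others and
  projects outside the hull of the graph. Thus the system is irredundant, its inequalities
  correspond to the facets, and omitting a facet means dropping one inequality.
\<close>

subsection \<open>Labellings of a cycle\<close>

lemma cycle_induct:
  fixes i k :: "'k::nontriv mod_ring"
  assumes "P k" and step: "\<And>i. P i \<Longrightarrow> P (i + 1)"
  shows "P i"
proof -
  have *: "P (k + of_nat m)" for m
  proof (induction m)
    case (Suc m)
    then show ?case
      using step[of "k + of_nat m"] by (simp add: ac_simps)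
  qed (use assms in simp)
  have "i - k = of_nat (nat (to_int_mod_ring (i - k)))"
  proof -
    have "to_int_mod_ring (i - k) \<ge> 0"
      using range_to_int_mod_ring[where 'a='k] by (metis atLeastLessThan_iff rangeI)
    then show ?thesis
      by (simp add: of_nat_of_int_mod_ring)
  qed
  then show ?thesis
    using *[of "nat (to_int_mod_ring (i - k))"] by (metis add.commute diff_add_cancel)
qed

lemma succ_neq_self: "i + 1 \<noteq> (i :: 'k::nontriv mod_ring)"
  by simp

lemma succ_succ_neq_self:
  assumes "CARD('k) \<ge> 3"
  shows "i + 1 + 1 \<noteq> (i :: 'k::nontriv mod_ring)"
proof
  assume "i + 1 + 1 = i"
  then have "(of_int 2 :: 'k mod_ring) = 0"
    by (simp add: add.assoc)
  then have "to_int_mod_ring (of_int_mod_ring 2 :: 'k mod_ring) = 0"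
    by (simp add: of_int_of_int_mod_ring)
  then show False
    using assms by (subst (asm) to_int_mod_ring_of_int_mod_ring) auto
qed

lemma sum_cycle_shift:
  "(\<Sum>i\<in>UNIV. f (i + 1)) = (\<Sum>i\<in>UNIV. f (i :: 'k::nontriv mod_ring))"
proof (rule sum.reindex_bij_betw[of "\<lambda>i. i + 1"])
  show "bij_betw (\<lambda>i::'k mod_ring. i + 1) UNIV UNIV"
    by (rule bij_betw_byWitness[where f'="\<lambda>i. i - 1"]) auto
qed

text \<open>A cut of a cycle has even size: modulo 2 a change is the sum of the labels at the two
  ends of its edge, and each label is counted twice.\<close>

lemma even_card_changes:
  fixes X :: "'k::nontriv mod_ring \<Rightarrow> bool"
  shows "even (card {i. X (i + 1) \<noteq> X i})"
proof -
  have "int (card {i. X (i + 1) \<noteq> X i}) = (\<Sum>i\<in>UNIV. of_bool (X (i + 1) \<noteq> X i))"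
    by (simp add: sum_of_bool_eq)
  also have "\<dots> = (\<Sum>i\<in>UNIV. of_bool (X (i + 1))) + (\<Sum>i\<in>UNIV. of_bool (X i))
      - 2 * (\<Sum>i\<in>UNIV. of_bool (X (i + 1) \<and> X i))"
    unfolding sum_distrib_left sum.distrib[symmetric] sum_subtractf[symmetric]
    by (intro sum.cong) auto
  also have "(\<Sum>i\<in>UNIV. of_bool (X (i + 1))) = (\<Sum>i\<in>UNIV. of_bool (X i) :: int)"
    by (rule sum_cycle_shift)
  finally show ?thesis
    by (metis (no_types, lifting) dvd_diff dvd_triv_left even_add even_of_nat)
qed

text \<open>Walk around the cycle from \<open>k + 1\<close> and flip the label on each edge of
  \<open>C\<close>. Only the closing edge \<open>k\<close> can fail; the parity of \<open>C\<close>
  decides.\<close>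

lemma cycle_labelling:
  fixes k :: "'k::nontriv mod_ring"
  obtains X where "\<And>i. i \<noteq> k \<Longrightarrow> X (i + 1) = (X i \<noteq> (i \<in> C))"
    and "X (k + 1) = (X k \<noteq> (k \<in> C)) \<longleftrightarrow> even (card C)"
proof -
  \<comment> \<open>\<open>r i\<close> counts the steps from \<open>k + 1\<close> to
    \<open>i\<close>, so that \<open>X i\<close> is the parity of the edges of \<open>C\<close>
    passed before \<open>i\<close>.\<close>
  define r where "r i = nat (to_int_mod_ring (i - (k + 1)))" for i
  define X where "X i = odd (card {j \<in> C. r j < r i})" for i
  have rng: "0 \<le> to_int_mod_ring j" "to_int_mod_ring j < int CARD('k)" for j :: "'k mod_ring"
    using range_to_int_mod_ring[where 'a='k] by (metis atLeastLessThan_iff rangeI)+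
  have inj: "r i = r j \<longleftrightarrow> i = j" for i j
    unfolding r_def using rng by (simp add: nat_eq_iff)
  have r_step: "r (i + 1) = r i + 1" if "i \<noteq> k" for i
  proof -
    define j where "j = i - (k + 1)"
    have eq: "to_int_mod_ring (j + 1) = (to_int_mod_ring j + 1) mod int CARD('k)"
      by transfer (simp add: mod_simps)
    have "to_int_mod_ring (j + 1) \<noteq> 0"
      using that by (simp add: j_def)
    then have "to_int_mod_ring j + 1 \<noteq> int CARD('k)"
      using eq by auto
    then have "to_int_mod_ring (j + 1) = to_int_mod_ring j + 1"
      using eq rng[of j] by simp
    moreover have "r (i + 1) = nat (to_int_mod_ring (j + 1))"
      by (simp add: r_def j_def algebra_simps)
    ultimately show ?thesis
      using rng[of j] by (simp add: r_def j_def)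
  qed
  have split: "{j \<in> C. r j < r i + 1} = {j \<in> C. r j < r i} \<union> (if i \<in> C then {i} else {})" for i
    using inj by (auto simp: less_Suc_eq)
  have X_step: "odd (card {j \<in> C. r j < r i + 1}) = (X i \<noteq> (i \<in> C))" for i
    unfolding split X_def by (auto simp: card_insert_if)
  have last: "C = {j \<in> C. r j < r k + 1}"
  proof -
    have "(-1 :: 'k mod_ring) = of_int_mod_ring (int CARD('k) - 1)"
      by (simp flip: of_int_of_int_mod_ring)
    then have "to_int_mod_ring (-1 :: 'k mod_ring) = int CARD('k) - 1"
      by (simp add: nontriv less_imp_le)
    then have "r k = CARD('k) - 1"
      by (simp add: r_def)
    then have "r j < r k + 1" for j
      using rng[of "j - (k + 1)"] by (simp add: r_def less_Suc_eq_le)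
    then show ?thesis by blast
  qed
  have "\<not> X (k + 1)"
    by (simp add: X_def r_def)
  then have "X (k + 1) = (X k \<noteq> (k \<in> C)) \<longleftrightarrow> even (card C)"
    using X_step[of k] unfolding last[symmetric] by auto
  moreover have "X (i + 1) = (X i \<noteq> (i \<in> C))" if "i \<noteq> k" for i
    using X_step[of i] r_step[OF that] by (simp add: X_def)
  ultimately show ?thesis
    using that by blast
qed

subsection \<open>Odd cycle inequalities and the Boolean quadric polytope\<close>

text \<open>
  Reading \<open>x i\<close> and \<open>y i\<close> as the probabilities of \<open>X i = 1\<close> and \<open>X i = X (i + 1) = 1\<close> for random
  labels \<open>X\<close>, the following is the probability that \<open>X i = p\<close> and \<open>X (i + 1) = q\<close>. The
  McCormick inequalities say that these numbers are nonnegative, and the odd cycle inequality of an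
  odd edge set \<open>D\<close> says that the expected number of edges on which the cut of \<open>X\<close> disagrees with
  \<open>D\<close> is at least 1. Inequality (A) is the case \<open>D = E\<^sup>-\<close>, and (B) the case \<open>D = E\<^sup>+\<close>.
\<close>

definition edge_prob :: "'k::nontriv xy_space \<Rightarrow> 'k mod_ring \<Rightarrow> bool \<Rightarrow> bool \<Rightarrow> real" where
  "edge_prob v i p q =
     (if p then (if q then snd v $ i else fst v $ i - snd v $ i)
      else (if q then fst v $ (i + 1) - snd v $ i
            else 1 - fst v $ i - fst v $ (i + 1) + snd v $ i))"

definition mismatch :: "'k::nontriv mod_ring set \<Rightarrow> 'k xy_space \<Rightarrow> real" where
  "mismatch D v = (\<Sum>i\<in>UNIV. edge_prob v i True (i \<in> D) + edge_prob v i False (i \<notin> D))"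

definition vertex :: "('k::nontriv mod_ring \<Rightarrow> bool) \<Rightarrow> 'k xy_space" where
  "vertex X = (\<chi> i. of_bool (X i), \<chi> i. of_bool (X i \<and> X (i + 1)))"

text \<open>Each edge looks as if its labels were uniform, opposite on \<open>D\<close> and equal
  off \<open>D\<close>. Such labels exist globally only for even \<open>D\<close>; for odd
  \<open>D\<close> the odd cycle inequality cuts this point off.\<close>

definition half_point :: "'k::nontriv mod_ring set \<Rightarrow> 'k xy_space" where
  "half_point D = (\<chi> i. 1 / 2, \<chi> i. if i \<in> D then 0 else 1 / 2)"

text \<open>For even \<open>D\<close> the bound is 0 and the set is the whole McCormick polytope, so
  one definition serves both parities.\<close>

definition odd_cycle_poly :: "'k::nontriv mod_ring set \<Rightarrow> 'k xy_space set" where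
  "odd_cycle_poly D = McCormick \<inter> {v. of_bool (odd (card D)) \<le> mismatch D v}"

lemma McCormick_iff: "v \<in> McCormick \<longleftrightarrow> (\<forall>i p q. 0 \<le> edge_prob v i p q)"
proof -
  have "(\<forall>p q. 0 \<le> edge_prob v i p q) \<longleftrightarrow> 0 \<le> snd v $ i \<and> snd v $ i \<le> fst v $ i \<and>
      snd v $ i \<le> fst v $ (i + 1) \<and> fst v $ i + fst v $ (i + 1) - snd v $ i \<le> 1" for i
    by (auto simp: edge_prob_def all_bool_eq)
  then show ?thesis
    by (simp add: McCormick_def case_prod_beta)
qed

lemma edge_prob_vertex: "edge_prob (vertex X) i p q = of_bool (X i = p \<and> X (i + 1) = q)"
  by (auto simp: edge_prob_def vertex_def)

text \<open>\<open>edge_prob\<close> is affine, not linear: the event of two labels 0 has the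
  constant term 1. Hence weights with sum 1.\<close>

lemma edge_prob_sum:
  assumes "(\<Sum>s\<in>S. l s) = 1"
  shows "edge_prob (\<Sum>s\<in>S. l s *\<^sub>R f s) i p q = (\<Sum>s\<in>S. l s * edge_prob (f s) i p q)"
  using assms
  by (auto simp: edge_prob_def fst_sum snd_sum sum_subtractf sum.distrib algebra_simps)

lemma edge_prob_convex_comb:
  "edge_prob ((1 - t) *\<^sub>R v + t *\<^sub>R w) i p q = (1 - t) * edge_prob v i p q + t * edge_prob w i p q"
  by (auto simp: edge_prob_def algebra_simps)

lemma edge_prob_line:
  "edge_prob (v + t *\<^sub>R w) i p q = edge_prob v i p q + t * (edge_prob w i p q - edge_prob 0 i p q)"
  by (auto simp: edge_prob_def algebra_simps)

lemma mismatch_convex_comb: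
  "mismatch D ((1 - t) *\<^sub>R v + t *\<^sub>R w) = (1 - t) * mismatch D v + t * mismatch D w"
  unfolding mismatch_def sum_distrib_left sum.distrib[symmetric]
  by (intro sum.cong refl) (simp only: edge_prob_convex_comb, simp add: algebra_simps)

lemma mismatch_nonneg: "v \<in> McCormick \<Longrightarrow> 0 \<le> mismatch D v"
  by (auto simp: mismatch_def McCormick_iff intro!: sum_nonneg add_nonneg_nonneg)

lemma continuous_edge_prob: "continuous_on UNIV (\<lambda>v. edge_prob v i p q)"
  by (cases p; cases q) (auto simp: edge_prob_def intro!: continuous_intros)

lemma continuous_mismatch: "continuous_on UNIV (mismatch D)"
  unfolding mismatch_def[abs_def] by (intro continuous_intros continuous_edge_prob)

lemma bounded_xy_box:
  "bounded {v :: 'k::nontriv xy_space. \<forall>i. \<bar>fst v $ i\<bar> \<le> 1 \<and> \<bar>snd v $ i\<bar> \<le> 1}"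
proof (rule bounded_subset)
  let ?B = "cbox (vec (-1)) (vec 1) :: 'k idx_vec set"
  show "bounded (?B \<times> ?B)"
    by (intro bounded_Times bounded_cbox)
  show "{v :: 'k xy_space. \<forall>i. \<bar>fst v $ i\<bar> \<le> 1 \<and> \<bar>snd v $ i\<bar> \<le> 1} \<subseteq> ?B \<times> ?B"
    by (auto simp: mem_box_cart abs_le_iff)
qed

lemma convex_odd_cycle_poly: "convex (odd_cycle_poly D)"
proof (rule convexI)
  fix v w :: "'a xy_space" and s t :: real
  assume vw: "v \<in> odd_cycle_poly D" "w \<in> odd_cycle_poly D" and st: "0 \<le> s" "0 \<le> t" "s + t = 1"
  have s: "s = 1 - t" using st by simp
  have "(1 - t) * of_bool (odd (card D)) + t * of_bool (odd (card D))
      \<le> (1 - t) * mismatch D v + t * mismatch D w"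
    using vw st by (intro add_mono mult_left_mono) (auto simp: odd_cycle_poly_def)
  then have "of_bool (odd (card D)) \<le> mismatch D (s *\<^sub>R v + t *\<^sub>R w)"
    unfolding s mismatch_convex_comb by (simp add: left_diff_distrib)
  moreover have "0 \<le> edge_prob (s *\<^sub>R v + t *\<^sub>R w) i p q" for i p q
    using vw st unfolding s edge_prob_convex_comb
    by (auto simp: odd_cycle_poly_def McCormick_iff)
  ultimately show "s *\<^sub>R v + t *\<^sub>R w \<in> odd_cycle_poly D"
    by (simp add: odd_cycle_poly_def McCormick_iff)
qed

lemma compact_odd_cycle_poly: "compact (odd_cycle_poly D)"
proof -
  have eq: "odd_cycle_poly D =
      (\<Inter>i. \<Inter>p. \<Inter>q. {v. 0 \<le> edge_prob v i p q}) \<inter> {v. of_bool (odd (card D)) \<le> mismatch D v}"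
    by (auto simp: odd_cycle_poly_def McCormick_iff)
  have "closed (odd_cycle_poly D)"
    unfolding eq
    by (intro closed_Int closed_INT ballI closed_Collect_le continuous_intros
        continuous_edge_prob continuous_mismatch)
  moreover have "bounded (odd_cycle_poly D)"
  proof (rule bounded_subset[OF bounded_xy_box])
    show "odd_cycle_poly D \<subseteq> {v. \<forall>i. \<bar>fst v $ i\<bar> \<le> 1 \<and> \<bar>snd v $ i\<bar> \<le> 1}"
      using McCormick_subset_unit_box by (fastforce simp: odd_cycle_poly_def)
  qed
  ultimately show ?thesis
    by (simp add: compact_eq_bounded_closed)
qed

section \<open>Points of the Boolean quadric polytope\<close>

lemma QP_cycle_vertices: "QP_cycle = convex hull (range vertex)"
proof -
  have "{(x, y). (\<forall>i. x $ i \<in> {0, 1}) \<and> (\<forall>i. y $ i \<in> {0, 1}) \<and>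
      (\<forall>i. y $ i = (x $ i) * (x $ (i + 1)))} = range (vertex :: _ \<Rightarrow> 'a xy_space)"
    (is "?L = _")
  proof (intro equalityI subsetI)
    fix v assume "v \<in> ?L"
    then obtain x y where v: "v = (x, y)" "\<forall>i. x $ i \<in> {0, 1}"
        "\<forall>i. y $ i = (x $ i) * (x $ (i + 1))"
      by auto
    have "vertex (\<lambda>i. x $ i = 1) = (x, y)"
      unfolding vertex_def using v(2,3)
      by (auto simp: vec_eq_iff)
    then show "v \<in> range vertex"
      unfolding v by (metis rangeI)
  qed (auto simp: vertex_def)
  then show ?thesis
    by (simp add: QP_cycle_def)
qed

lemma vertex_in_QP: "vertex X \<in> QP_cycle"
  by (simp add: QP_cycle_vertices hull_inc)

lemma convex_QP: "convex QP_cycle"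
  by (simp add: QP_cycle_def)

text \<open>The difference \<open>g\<close> of the x-parts is negated across edges of
  \<open>D\<close> and kept across the others. If nonzero at one vertex, it is nonzero everywhere
  and \<open>D\<close> is its set of sign changes, which is even.\<close>

lemma edge_prob_odd_cycle_inject:
  assumes odd: "odd (card D)"
    and eq: "\<And>i p. edge_prob v i p (p = (i \<in> D)) = edge_prob w i p (p = (i \<in> D))"
  shows "v = w"
proof -
  define g where "g i = fst v $ i - fst w $ i" for i
  define h where "h i = snd v $ i - snd w $ i" for i
  have on: "h i = 0 \<and> g (i + 1) = - g i" if "i \<in> D" for i
    using eq[of i True] eq[of i False] that by (auto simp: edge_prob_def g_def h_def)
  have off: "h i = g i \<and> g (i + 1) = g i" if "i \<notin> D" for i
    using eq[of i True] eq[of i False] that by (auto simp: edge_prob_def g_def h_def)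
  have g0: "g i = 0" for i
  proof (rule ccontr)
    assume "g i \<noteq> 0"
    have "g (j + 1) \<noteq> 0" if "g j \<noteq> 0" for j
      using on[of j] off[of j] that by (cases "j \<in> D") auto
    then have nz: "g j \<noteq> 0" for j
      using cycle_induct[of "\<lambda>j. g j \<noteq> 0" i j] \<open>g i \<noteq> 0\<close> by blast
    have "j \<in> D \<longleftrightarrow> (g (j + 1) > 0) \<noteq> (g j > 0)" for j
      using on[of j] off[of j] nz[of j] by (cases "j \<in> D") auto
    then have "D = {j. (g (j + 1) > 0) \<noteq> (g j > 0)}"
      by blast
    then show False
      using odd even_card_changes[of "\<lambda>j. g j > 0"] by simp
  qed
  moreover have "h i = 0" for i
    using on[of i] off[of i] g0 by (cases "i \<in> D") auto
  ultimately show ?thesis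
    by (auto simp: g_def h_def prod_eq_iff vec_eq_iff)
qed

text \<open>
  This face is a simplex: its vertices are indexed by the only mismatched edge \<open>k\<close> together with the
  label of \<open>k\<close>, and the barycentric coordinates are the slacks of the McCormick inequalities of the
  mismatch events.
\<close>

lemma odd_cycle_facet_in_QP:
  assumes odd: "odd (card D)" and v: "v \<in> McCormick" and tight: "mismatch D v = 1"
  shows "v \<in> QP_cycle"
proof -
  have "\<exists>X. X k = b \<and> (\<forall>i. X (i + 1) = (X i = (i \<in> D)) \<longleftrightarrow> i = k)" for k b
  proof -
    obtain X where X: "\<And>i. i \<noteq> k \<Longrightarrow> X (i + 1) = (X i \<noteq> (i \<in> D))"
        "X (k + 1) = (X k \<noteq> (k \<in> D)) \<longleftrightarrow> even (card D)"
      by (rule cycle_labelling[of k D]) blast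
    \<comment> \<open>Complementing all labels keeps the mismatched edges, so the label of
      \<open>k\<close> can be prescribed.\<close>
    show ?thesis
    proof (intro exI[of _ "\<lambda>i. X i \<noteq> (X k \<noteq> b)"] conjI allI)
      fix i
      show "((X (i + 1) \<noteq> (X k \<noteq> b)) = ((X i \<noteq> (X k \<noteq> b)) = (i \<in> D))) \<longleftrightarrow> i = k"
        using X(1)[of i] X(2) odd by (cases "i = k") auto
    qed auto
  qed
  then obtain X where X: "\<And>k b. X k b k = b"
      "\<And>k b i. X k b (i + 1) = (X k b i = (i \<in> D)) \<longleftrightarrow> i = k"
    by metis
  define l where "l = (\<lambda>(k, b). edge_prob v k b (b = (k \<in> D)))"
  have l1: "sum l UNIV = 1"
  proof -
    have "sum l UNIV = (\<Sum>k\<in>UNIV. \<Sum>b\<in>UNIV. l (k, b))"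
      by (simp add: sum.cartesian_product)
    also have "\<dots> = mismatch D v"
      by (simp add: mismatch_def l_def UNIV_bool add.commute)
    finally show ?thesis using tight by simp
  qed
  define w where "w = (\<Sum>s\<in>UNIV. l s *\<^sub>R vertex (X (fst s) (snd s)))"
  have "edge_prob w j c (c = (j \<in> D)) = edge_prob v j c (c = (j \<in> D))" for j c
  proof -
    have "edge_prob w j c (c = (j \<in> D)) =
        (\<Sum>s\<in>UNIV. l s * edge_prob (vertex (X (fst s) (snd s))) j c (c = (j \<in> D)))"
      unfolding w_def by (rule edge_prob_sum[OF l1])
    also have "\<dots> = (\<Sum>s\<in>UNIV. if s = (j, c) then l s else 0)"
    proof (rule sum.cong[OF refl])
      fix s :: "'a mod_ring \<times> bool"
      obtain k b where s: "s = (k, b)" by (cases s)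
      \<comment> \<open>A mismatch event of edge \<open>j\<close> occurs only at a vertex whose
        unique mismatched edge is \<open>j\<close>, so the sum has a single term.\<close>
      have "(X k b j = c \<and> X k b (j + 1) = (c = (j \<in> D))) \<longleftrightarrow> k = j \<and> b = c"
        using X by metis
      then show "l s * edge_prob (vertex (X (fst s) (snd s))) j c (c = (j \<in> D))
          = (if s = (j, c) then l s else 0)"
        by (auto simp: edge_prob_vertex s)
    qed
    also have "\<dots> = edge_prob v j c (c = (j \<in> D))"
      by (simp add: l_def)
    finally show ?thesis .
  qed
  then have "w = v"
    by (rule edge_prob_odd_cycle_inject[OF odd])
  moreover have "w \<in> QP_cycle"
    unfolding w_def using v
    by (intro convex_sum convex_QP l1 vertex_in_QP) (auto simp: l_def McCormick_iff)
  ultimately show ?thesis by simp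
qed

text \<open>An even \<open>D\<close> is the cut of a labelling \<open>X\<close>; the point is the
  midpoint of \<open>X\<close> and its complement.\<close>

lemma half_point_in_QP:
  assumes "even (card D)"
  shows "half_point D \<in> QP_cycle"
proof -
  obtain X where "\<And>i. i \<noteq> 0 \<Longrightarrow> X (i + 1) = (X i \<noteq> (i \<in> D))"
      "X (0 + 1) = (X 0 \<noteq> (0 \<in> D)) \<longleftrightarrow> even (card D)"
    by (rule cycle_labelling[of 0 D]) blast
  then have X: "X (i + 1) = (X i \<noteq> (i \<in> D))" for i
    using assms by (cases "i = 0") auto
  have "half_point D = (1/2) *\<^sub>R vertex X + (1/2) *\<^sub>R vertex (\<lambda>i. \<not> X i)"
    using X by (auto simp: half_point_def vertex_def vec_eq_iff)
  also have "\<dots> \<in> QP_cycle"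
    by (intro convexD[OF convex_QP] vertex_in_QP) auto
  finally show ?thesis .
qed

lemma McCormick_integral:
  assumes v: "v \<in> McCormick" and x: "\<And>i. fst v $ i \<in> {0, 1}"
  shows "v = vertex (\<lambda>i. fst v $ i = 1)"
proof -
  have "fst v $ i = of_bool (fst v $ i = 1)" for i
    using x[of i] by auto
  moreover have "snd v $ i = of_bool (fst v $ i = 1 \<and> fst v $ (i + 1) = 1)" for i
  proof -
    have "0 \<le> edge_prob v i p q" for p q
      using v by (simp add: McCormick_iff)
    from this[of True True] this[of True False] this[of False True] this[of False False]
    show ?thesis using x[of i] x[of "i + 1"] by (auto simp: edge_prob_def)
  qed
  ultimately show ?thesis
    by (simp add: vertex_def prod_eq_iff vec_eq_iff)
qed

section \<open>Extreme points away from the odd cycle facet\<close>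

lemma not_extreme_point_odd_cycle_poly:
  assumes v: "v \<in> McCormick" and slack: "even (card D) \<or> 1 < mismatch D v" and "w \<noteq> 0"
    and tight: "\<And>i p q. edge_prob v i p q = 0 \<Longrightarrow> edge_prob w i p q = edge_prob 0 i p q"
  shows "\<not> v extreme_point_of odd_cycle_poly D"
proof -
  \<comment> \<open>Inequalities tight at \<open>v\<close> stay tight along \<open>w\<close>; the
    others survive a short move either way.\<close>
  have McC: "\<forall>\<^sub>F t in nhds 0. v + t *\<^sub>R w \<in> McCormick"
    unfolding McCormick_iff
  proof (intro eventually_all_finite)
    fix i p q
    show "\<forall>\<^sub>F t in nhds 0. 0 \<le> edge_prob (v + t *\<^sub>R w) i p q"
    proof (cases "edge_prob v i p q = 0")
      case True
      then show ?thesis using tight by (simp add: edge_prob_line)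
    next
      case False
      then have "0 < edge_prob v i p q" using v by (simp add: McCormick_iff order_less_le)
      moreover have "((\<lambda>t. edge_prob (v + t *\<^sub>R w) i p q) \<longlongrightarrow> edge_prob v i p q + 0 * (edge_prob w i p q - edge_prob 0 i p q)) (nhds 0)"
        unfolding edge_prob_line by (intro tendsto_intros) (simp add: filterlim_ident)
      ultimately show ?thesis
        by (auto dest!: order_tendstoD(1) elim: eventually_mono)
    qed
  qed
  have "\<forall>\<^sub>F t in nhds 0. v + t *\<^sub>R w \<in> odd_cycle_poly D"
  proof (cases "even (card D)")
    case True
    with McC show ?thesis
      by (auto simp: odd_cycle_poly_def mismatch_nonneg elim!: eventually_mono)
  next
    case False
    have "isCont (mismatch D) v"
      using continuous_mismatch continuous_on_eq_continuous_at open_UNIV by blast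
    moreover have "((\<lambda>t. v + t *\<^sub>R w) \<longlongrightarrow> v + 0 *\<^sub>R w) (nhds 0)"
      by (intro tendsto_intros) (simp add: filterlim_ident)
    ultimately have "((\<lambda>t. mismatch D (v + t *\<^sub>R w)) \<longlongrightarrow> mismatch D v) (nhds 0)"
      by (intro isCont_tendsto_compose[of v "mismatch D"]) auto
    then have "\<forall>\<^sub>F t in nhds 0. 1 < mismatch D (v + t *\<^sub>R w)"
      using slack False by (auto dest: order_tendstoD(1))
    with McC show ?thesis
      by eventually_elim (auto simp: odd_cycle_poly_def False)
  qed
  then obtain e where e: "e > 0" "\<And>t. dist t 0 < e \<Longrightarrow> v + t *\<^sub>R w \<in> odd_cycle_poly D"
    unfolding eventually_nhds_metric by blast
  let ?a = "v + (- (e / 2)) *\<^sub>R w" and ?b = "v + (e / 2) *\<^sub>R w"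
  have "?a \<in> odd_cycle_poly D" "?b \<in> odd_cycle_poly D"
    using e(1) e(2)[of "- (e / 2)"] e(2)[of "e / 2"] by (simp_all add: dist_real_def)
  moreover have "v = midpoint ?a ?b"
    by (simp add: midpoint_def algebra_simps flip: scaleR_add_left)
  moreover have "?a \<noteq> ?b"
    using e(1) \<open>w \<noteq> 0\<close> by (auto simp: algebra_simps simp flip: scaleR_add_left)
  ultimately show ?thesis
    unfolding extreme_point_of_def using midpoint_in_open_segment by metis
qed

text \<open>A direction \<open>d\<close> for \<open>x\<close> extends to \<open>y\<close> by letting
  each \<open>y i\<close> follow a tight McCormick inequality of edge \<open>i\<close>. The
  conditions on \<open>d\<close> resolve the conflicts between two tight ones; a nonzero
  \<open>d\<close> would then move the point both ways.\<close>

lemma extreme_point_direction_zero: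
  fixes x y :: "'k::nontriv idx_vec" and d :: "'k mod_ring \<Rightarrow> real"
  assumes v: "(x, y) extreme_point_of odd_cycle_poly D"
    and slack: "even (card D) \<or> 1 < mismatch D (x, y)"
    and "\<And>i. x $ i \<in> {0, 1} \<Longrightarrow> d i = 0"
    and "\<And>i. x $ i = x $ (i + 1) \<Longrightarrow> y $ i = x $ i \<Longrightarrow> d i = d (i + 1)"
    and "\<And>i. x $ i + x $ (i + 1) = 1 \<Longrightarrow> y $ i = 0 \<Longrightarrow> d i + d (i + 1) = 0"
  shows "d j = 0"
proof (rule ccontr)
  assume "d j \<noteq> 0"
  define e where "e i = (if y $ i = 0 then 0 else if y $ i = x $ i then d i
     else if y $ i = x $ (i + 1) then d (i + 1) else d i + d (i + 1))" for i
  define w where "w = (\<chi> i. d i, \<chi> i. e i)"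
  have e1: "e i = 0" if "y $ i = 0" for i
    using that by (simp add: e_def)
  have e2: "e i = d i" if "y $ i = x $ i" for i
    using that assms(3)[of i] by (auto simp: e_def)
  have e3: "e i = d (i + 1)" if "y $ i = x $ (i + 1)" for i
    using that assms(3)[of "i + 1"] assms(4)[of i] by (auto simp: e_def)
  have e4: "e i = d i + d (i + 1)" if "y $ i = x $ i + x $ (i + 1) - 1" for i
  proof -
    have "d i + d (i + 1) = 0" if "y $ i = 0"
      using that \<open>y $ i = x $ i + x $ (i + 1) - 1\<close> by (intro assms(5)) auto
    moreover have "d (i + 1) = 0" if "y $ i = x $ i"
      using that \<open>y $ i = x $ i + x $ (i + 1) - 1\<close> by (intro assms(3)) auto
    moreover have "d i = 0" if "y $ i = x $ (i + 1)"
      using that \<open>y $ i = x $ i + x $ (i + 1) - 1\<close> by (intro assms(3)) auto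
    ultimately show ?thesis
      by (simp add: e_def)
  qed
  have "w \<noteq> 0"
    using \<open>d j \<noteq> 0\<close> by (auto simp: w_def prod_eq_iff vec_eq_iff)
  moreover have "edge_prob w i p q = edge_prob 0 i p q" if "edge_prob (x, y) i p q = 0" for i p q
    using that e1[of i] e2[of i] e3[of i] e4[of i]
    by (cases p; cases q) (simp_all add: edge_prob_def w_def)
  moreover have "(x, y) \<in> McCormick"
    using v by (auto simp: extreme_point_of_def odd_cycle_poly_def)
  ultimately show False
    using not_extreme_point_odd_cycle_poly[OF _ slack] v by blast
qed

lemma extreme_point_integral_or_half:
  assumes v: "(x, y) extreme_point_of odd_cycle_poly D"
    and slack: "even (card D) \<or> 1 < mismatch D (x, y)"
  shows "(\<forall>i. x $ i \<in> {0, 1}) \<or> (\<forall>i. x $ i = 1 / 2)"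
proof -
  note dir = extreme_point_direction_zero[OF v slack]
  have unit: "0 \<le> x $ i" "x $ i \<le> 1" for i
    using v McCormick_subset_unit_box[of x y i]
    by (auto simp: extreme_point_of_def odd_cycle_poly_def)
  have three: "x $ i \<in> {0, 1 / 2, 1}" for i
  proof (rule ccontr)
    assume i: "x $ i \<notin> {0, 1 / 2, 1}"
    define r where "r = \<bar>x $ i - 1 / 2\<bar>"
    have r: "0 < r" "r < 1 / 2"
      using i unit[of i] by (auto simp: r_def abs_if)
    \<comment> \<open>All coordinates at distance \<open>r\<close> from 1/2 move away from 1/2
      equally fast. This respects equal and complementary neighbours, and \<open>r < 1 / 2\<close>
      keeps 0 and 1 fixed.\<close>
    have "(if \<bar>x $ i - 1 / 2\<bar> = r then sgn (x $ i - 1 / 2) else 0) = 0"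
    proof (rule dir)
      fix j assume "x $ j + x $ (j + 1) = 1"
      then have "x $ (j + 1) - 1 / 2 = - (x $ j - 1 / 2)" by simp
      then show "(if \<bar>x $ j - 1 / 2\<bar> = r then sgn (x $ j - 1 / 2) else 0) +
          (if \<bar>x $ (j + 1) - 1 / 2\<bar> = r then sgn (x $ (j + 1) - 1 / 2) else 0) = 0"
        by (simp only: abs_minus sgn_minus) simp
    qed (use r in auto)
    then show False
      using r by (auto simp: r_def sgn_if split: if_splits)
  qed
  show ?thesis
  proof (rule ccontr)
    assume "\<not> ?thesis"
    then obtain i j where ij: "x $ i = 1 / 2" "x $ j \<noteq> 1 / 2"
      using three by blast
    \<comment> \<open>The sign labelling may fail at edge \<open>j\<close>, because the direction is
      0 at the vertex \<open>j\<close>.\<close>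
    obtain X where X: "\<And>i. i \<noteq> j \<Longrightarrow> X (i + 1) = (X i \<noteq> (i \<in> {i. y $ i = 0}))"
      by (rule cycle_labelling[of j "{i. y $ i = 0}"]) blast
    have "(if x $ i = 1 / 2 then if X i then 1 else - 1 else 0) = (0::real)"
    proof (rule dir)
      fix k assume "x $ k = x $ (k + 1)" "y $ k = x $ k"
      then show "(if x $ k = 1 / 2 then if X k then 1 else - 1 else 0) =
          (if x $ (k + 1) = 1 / 2 then if X (k + 1) then 1 else - 1 else (0::real))"
        using X[of k] ij(2) by (cases "k = j") auto
    next
      fix k assume "x $ k + x $ (k + 1) = 1" "y $ k = 0"
      then show "(if x $ k = 1 / 2 then if X k then 1 else - 1 else 0) +
          (if x $ (k + 1) = 1 / 2 then if X (k + 1) then 1 else - 1 else 0) = (0::real)"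
        using X[of k] ij(2) by (cases "k = j") auto
    qed auto
    then show False
      using ij(1) by (simp split: if_splits)
  qed
qed

section \<open>Domination of half-integral points\<close>

lemma edge_prob_half_point:
  "edge_prob (half_point D) i p q = (if (p = q) = (i \<in> D) then 0 else 1 / 2)"
  by (auto simp: edge_prob_def half_point_def)

lemma half_point_in_McCormick: "half_point D \<in> McCormick"
  by (simp add: McCormick_iff edge_prob_half_point)

lemma mismatch_half_point: "mismatch D (half_point D) = 0"
  by (simp add: mismatch_def edge_prob_half_point)

text \<open>Over \<open>x i = 1 / 2\<close> the McCormick inequalities confine \<open>y i\<close> to
  values from 0 to 1/2; the half point takes the better end for the sign of
  \<open>b i\<close>.\<close>

lemma half_point_dominates:
  assumes v: "v \<in> McCormick" and half: "\<And>i. fst v $ i = 1 / 2"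
  shows "b i * snd v $ i \<le> b i * snd (half_point {i. b i < 0}) $ i"
proof -
  have "0 \<le> edge_prob v i True True" "0 \<le> edge_prob v i True False"
    using v by (auto simp: McCormick_iff)
  then have "0 \<le> snd v $ i" "snd v $ i \<le> 1 / 2"
    using half by (auto simp: edge_prob_def)
  then show ?thesis
    by (auto simp: half_point_def mult_left_mono mult_nonpos_nonneg not_less simp del: times_divide_eq_right)
qed

lemma half_vector_dominated:
  assumes v: "v \<in> odd_cycle_poly {i. b i < 0}" and half: "\<And>i. fst v $ i = 1 / 2"
  shows "\<exists>y. (fst v, y) \<in> QP_cycle \<and> (\<Sum>i\<in>UNIV. b i * snd v $ i) \<le> (\<Sum>i\<in>UNIV. b i * y $ i)"
proof -
  define D where "D = {i. b i < 0}"
  let ?s = "\<lambda>v. (\<Sum>i\<in>UNIV. b i * snd v $ i)"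
  have vM: "v \<in> McCormick" using v by (simp add: odd_cycle_poly_def)
  have le: "?s v \<le> ?s (half_point D)"
    unfolding D_def by (intro sum_mono half_point_dominates vM half)
  have fst_half: "fst (half_point D) = fst v"
    using half by (simp add: half_point_def vec_eq_iff)
  show ?thesis
  proof (cases "even (card D)")
    case True
    then have "(fst v, snd (half_point D)) \<in> QP_cycle"
      using half_point_in_QP[OF True] fst_half by (metis prod.collapse)
    then show ?thesis using le by blast
  next
    case odd: False
    define m where "m = mismatch D v"
    have m: "m \<ge> 1" using v odd by (simp add: m_def odd_cycle_poly_def D_def)
    \<comment> \<open>The mismatch is affine, 0 at the half point and \<open>m\<close> at
      \<open>v\<close>, so the weight \<open>1 / m\<close> makes it 1.\<close>
    define w where "w = (1 - 1 / m) *\<^sub>R half_point D + (1 / m) *\<^sub>R v"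
    have "edge_prob w i p q \<ge> 0" for i p q
      unfolding w_def edge_prob_convex_comb
      using m vM half_point_in_McCormick[of D] by (auto simp: McCormick_iff)
    then have "w \<in> McCormick" by (simp add: McCormick_iff)
    moreover have "mismatch D w = 1"
      using m unfolding w_def mismatch_convex_comb by (simp add: mismatch_half_point flip: m_def)
    ultimately have "w \<in> QP_cycle"
      using odd by (intro odd_cycle_facet_in_QP[of D])
    moreover have "fst w = fst v"
      by (simp add: w_def fst_half flip: scaleR_add_left)
    moreover have "?s v \<le> ?s w"
    proof -
      have "?s w = (1 - 1 / m) * ?s (half_point D) + (1 / m) * ?s v"
        unfolding sum_distrib_left sum.distrib[symmetric]
        by (intro sum.cong refl) (simp add: w_def algebra_simps)
      moreover have "(1 - 1 / m) * ?s v \<le> (1 - 1 / m) * ?s (half_point D)"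
        using m le by (intro mult_left_mono) auto
      ultimately show ?thesis by (simp add: algebra_simps)
    qed
    ultimately show ?thesis by (metis prod.collapse)
  qed
qed

text \<open>
  The dominated points form a convex set, so by Krein-Milman only extreme points need to be
  considered.
\<close>

lemma odd_cycle_poly_dominated:
  assumes v: "v \<in> odd_cycle_poly {i. b i < 0}"
  shows "\<exists>y. (fst v, y) \<in> QP_cycle \<and> (\<Sum>i\<in>UNIV. b i * snd v $ i) \<le> (\<Sum>i\<in>UNIV. b i * y $ i)"
proof -
  define D where "D = {i. b i < 0}"
  define S where "S = {v. \<exists>y. (fst v, y) \<in> QP_cycle \<and>
      (\<Sum>i\<in>UNIV. b i * snd v $ i) \<le> (\<Sum>i\<in>UNIV. b i * y $ i)}"
  have "convex S"
  proof (rule convexI)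
    fix v w and s t :: real assume vw: "v \<in> S" "w \<in> S" and st: "0 \<le> s" "0 \<le> t" "s + t = 1"
    obtain y where y: "(fst v, y) \<in> QP_cycle" "(\<Sum>i\<in>UNIV. b i * snd v $ i) \<le> (\<Sum>i\<in>UNIV. b i * y $ i)"
      using vw by (auto simp: S_def)
    obtain z where z: "(fst w, z) \<in> QP_cycle" "(\<Sum>i\<in>UNIV. b i * snd w $ i) \<le> (\<Sum>i\<in>UNIV. b i * z $ i)"
      using vw by (auto simp: S_def)
    have "s *\<^sub>R (fst v, y) + t *\<^sub>R (fst w, z) \<in> QP_cycle"
      using st y z by (intro convexD[OF convex_QP])
    moreover have "s * (\<Sum>i\<in>UNIV. b i * snd v $ i) + t * (\<Sum>i\<in>UNIV. b i * snd w $ i)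
        \<le> s * (\<Sum>i\<in>UNIV. b i * y $ i) + t * (\<Sum>i\<in>UNIV. b i * z $ i)"
      using st y z by (intro add_mono mult_left_mono)
    ultimately show "s *\<^sub>R v + t *\<^sub>R w \<in> S"
      unfolding S_def
      by (intro CollectI exI[of _ "s *\<^sub>R y + t *\<^sub>R z"])
        (simp add: sum_distrib_left sum.distrib algebra_simps)
  qed
  moreover have "e \<in> S" if e: "e extreme_point_of odd_cycle_poly D" for e
  proof -
    have eK: "e \<in> odd_cycle_poly D" using e by (simp add: extreme_point_of_def)
    then have eM: "e \<in> McCormick" by (simp add: odd_cycle_poly_def)
    have QP: "e \<in> S" if "e \<in> QP_cycle"
      using that unfolding S_def by (intro CollectI exI[of _ "snd e"]) simp
    show ?thesis
    proof (cases "even (card D) \<or> 1 < mismatch D e")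
      case False
      then have "mismatch D e = 1" using eK by (auto simp: odd_cycle_poly_def)
      then show ?thesis using odd_cycle_facet_in_QP False eM QP by blast
    next
      case True
      then consider "\<forall>i. fst e $ i \<in> {0, 1}" | "\<forall>i. fst e $ i = 1 / 2"
        using extreme_point_integral_or_half[of "fst e" "snd e" D] e by auto
      then show ?thesis
      proof cases
        case 1
        then show ?thesis using McCormick_integral[OF eM] vertex_in_QP QP by metis
      next
        case 2
        then show ?thesis using half_vector_dominated[of e b] eK by (auto simp: S_def D_def)
      qed
    qed
  qed
  ultimately have "convex hull {e. e extreme_point_of odd_cycle_poly D} \<subseteq> S"
    by (intro hull_minimal) auto
  then have "v \<in> S"
    using v Krein_Milman_Minkowski[OF compact_odd_cycle_poly convex_odd_cycle_poly, of D]
    by (auto simp: D_def)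
  then show ?thesis by (simp add: S_def)
qed

subsection \<open>Projections\<close>

lemma sum_over_UNIV: "(\<Sum>i\<in>A. f i) = (\<Sum>i\<in>UNIV. of_bool (i \<in> A) * (f i :: real))"
  for A :: "'a::finite set"
proof -
  have "(\<Sum>i\<in>A. f i) = (\<Sum>i\<in>UNIV. if i \<in> A then f i else 0)"
    by (simp add: sum.If_cases)
  also have "\<dots> = (\<Sum>i\<in>UNIV. of_bool (i \<in> A) * f i)"
    by (intro sum.cong) auto
  finally show ?thesis .
qed

text \<open>With signs \<open>s\<close>, -1 on \<open>D\<close> and 1 off it, \<open>x i\<close>
  gets the coefficient \<open>s (i - 1) + s i\<close>. It vanishes unless both edges at
  \<open>i\<close> lie on the same side, which gives the vertex sets of (A) and (B).\<close>

lemma mismatch_eq: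
  "mismatch D v = real (card D) - 2 * ((\<Sum>i\<in>{i. {i - 1, i} \<subseteq> D}. fst v $ i)
     - (\<Sum>i\<in>{i. {i - 1, i} \<subseteq> - D}. fst v $ i) + (\<Sum>i\<in>- D. snd v $ i) - (\<Sum>i\<in>D. snd v $ i))"
proof -
  define s :: "'a mod_ring \<Rightarrow> real" where "s i = (if i \<in> D then - 1 else 1)" for i
  have "mismatch D v = (\<Sum>i\<in>UNIV. of_bool (i \<in> D) + s i * fst v $ i + s i * fst v $ (i + 1) - 2 * (s i * snd v $ i))"
    unfolding mismatch_def by (intro sum.cong refl) (auto simp: edge_prob_def s_def)
  also have "\<dots> = real (card D) + (\<Sum>i\<in>UNIV. s i * fst v $ i) + (\<Sum>i\<in>UNIV. s i * fst v $ (i + 1))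
      - 2 * (\<Sum>i\<in>UNIV. s i * snd v $ i)"
    by (simp add: sum.distrib sum_subtractf sum_distrib_left sum_of_bool_eq)
  also have "(\<Sum>i\<in>UNIV. s i * fst v $ (i + 1)) = (\<Sum>i\<in>UNIV. s (i - 1) * fst v $ i)"
    using sum_cycle_shift[of "\<lambda>i. s (i - 1) * fst v $ i"] by simp
  finally have 1: "mismatch D v = real (card D) + (\<Sum>i\<in>UNIV. s i * fst v $ i)
      + (\<Sum>i\<in>UNIV. s (i - 1) * fst v $ i) - 2 * (\<Sum>i\<in>UNIV. s i * snd v $ i)" .
  have 2: "(\<Sum>i\<in>UNIV. s i * fst v $ i) + (\<Sum>i\<in>UNIV. s (i - 1) * fst v $ i) =
      - 2 * ((\<Sum>i\<in>{i. {i - 1, i} \<subseteq> D}. fst v $ i) - (\<Sum>i\<in>{i. {i - 1, i} \<subseteq> - D}. fst v $ i))"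
    unfolding sum_over_UNIV[of "\<lambda>i. fst v $ i"] sum_subtractf[symmetric] sum.distrib[symmetric]
      sum_distrib_left
    by (intro sum.cong refl) (auto simp: s_def)
  have 3: "(\<Sum>i\<in>UNIV. s i * snd v $ i) = (\<Sum>i\<in>- D. snd v $ i) - (\<Sum>i\<in>D. snd v $ i)"
    unfolding sum_over_UNIV[of "\<lambda>i. snd v $ i"] sum_subtractf[symmetric]
    by (intro sum.cong refl) (auto simp: s_def)
  have arith: "m = c + u + w - 2 * t \<Longrightarrow> u + w = - 2 * (p - q) \<Longrightarrow> t = r - z \<Longrightarrow>
      m = c - 2 * (p - q + r - z)" for m c u w t p q r z :: real
    by argo
  show ?thesis
    by (rule arith[OF 1 2 3])
qed

text \<open>Rounding \<open>n / 2\<close> down loses half the parity of \<open>n\<close>; this turns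
  the floors in (A) and (B) into the bounds 0 and 1.\<close>

lemma le_half_floor_iff:
  "x \<le> of_int \<lfloor>real n / 2\<rfloor> \<longleftrightarrow> of_bool (odd n) \<le> real n - 2 * x"
proof -
  have "\<lfloor>real n / 2\<rfloor> = int (n div 2)"
    using floor_divide_of_nat_eq[of n 2] by simp
  moreover have "real n = 2 * real (n div 2) + of_bool (odd n)"
    by (cases "even n") (auto elim!: evenE oddE)
  ultimately show ?thesis by auto
qed

lemma E_pos_eq: "\<forall>i. a i \<noteq> 0 \<Longrightarrow> E_pos a = - E_neg a"
  by (auto simp: E_pos_def E_neg_def not_less order_less_le)

lemma McCormick_halfspace_A:
  assumes "\<forall>i. a i \<noteq> 0"
  shows "McCormick \<inter> halfspace_A a = odd_cycle_poly (E_neg a)"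
  by (auto simp: odd_cycle_poly_def halfspace_A_def V_neg_def V_pos_def E_pos_eq[OF assms]
      le_half_floor_iff mismatch_eq)

lemma McCormick_halfspace_B:
  assumes "\<forall>i. a i \<noteq> 0"
  shows "McCormick \<inter> halfspace_B a = odd_cycle_poly (- E_neg a)"
  by (auto simp: odd_cycle_poly_def halfspace_B_def V_neg_def V_pos_def E_pos_eq[OF assms]
      le_half_floor_iff mismatch_eq)

section \<open>The graph hull and projections of the relaxations\<close>

lemma linear_lift_proj: "linear (lift_proj a)"
  by (rule linearI)
    (auto simp: lift_proj_def case_prod_beta sum.distrib sum_distrib_left algebra_simps)

text \<open>These are the moments of independent labels. No product contains \<open>x k\<close>
  twice, so the point is affine in \<open>x k\<close>, and fractional coordinates are split into 0
  and 1 one by one.\<close>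

lemma bilinear_point_in_QP:
  assumes "\<And>i. x $ i \<in> {0..1}"
  shows "(x, \<chi> i. x $ i * x $ (i + 1)) \<in> QP_cycle"
  using assms
proof (induction "card {i. x $ i \<notin> {0, 1}}" arbitrary: x rule: less_induct)
  case less
  show ?case
  proof (cases "\<forall>i. x $ i \<in> {0, 1}")
    case True
    then have *: "x $ i \<in> {0, 1}" for i
      by blast
    have "x = (\<chi> i. of_bool (x $ i = 1))"
      unfolding vec_eq_iff vec_lambda_beta using * by auto
    moreover have "x $ i * x $ (i + 1) = of_bool (x $ i = 1 \<and> x $ (i + 1) = 1)" for i
      using *[of i] *[of "i + 1"] by auto
    ultimately have "(x, \<chi> i. x $ i * x $ (i + 1)) = vertex (\<lambda>i. x $ i = 1)"
      by (simp add: vertex_def)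
    then show ?thesis using vertex_in_QP by metis
  next
    case False
    then obtain k where k: "x $ k \<notin> {0, 1}" by blast
    define z where "z t = (\<chi> i. if i = k then t else x $ i)" for t
    have "{i. z t $ i \<notin> {0, 1}} \<subset> {i. x $ i \<notin> {0, 1}}" if "t \<in> {0, 1}" for t
      using k that by (auto simp: z_def)
    then have c: "card {i. z t $ i \<notin> {0, 1}} < card {i. x $ i \<notin> {0, 1}}" if "t \<in> {0, 1}" for t
      using that by (intro psubset_card_mono) auto
    have u: "z t $ i \<in> {0..1}" if "t \<in> {0, 1}" for t i
      using that less.prems[of i] by (auto simp: z_def)
    have IH: "(z t, \<chi> i. z t $ i * z t $ (i + 1)) \<in> QP_cycle" if "t \<in> {0, 1}" for t
      using that by (intro less.hyps c u)
    have "(x, \<chi> i. x $ i * x $ (i + 1)) =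
        (1 - x $ k) *\<^sub>R (z 0, \<chi> i. z 0 $ i * z 0 $ (i + 1)) +
        x $ k *\<^sub>R (z 1, \<chi> i. z 1 $ i * z 1 $ (i + 1))"
      unfolding prod_eq_iff vec_eq_iff
    proof (intro conjI allI)
      fix i
      show "snd (x, \<chi> i. x $ i * x $ (i + 1)) $ i =
          snd ((1 - x $ k) *\<^sub>R (z 0, \<chi> i. z 0 $ i * z 0 $ (i + 1)) +
            x $ k *\<^sub>R (z 1, \<chi> i. z 1 $ i * z 1 $ (i + 1))) $ i"
        using succ_neq_self[of k] by (cases "i = k"; cases "i + 1 = k") (auto simp: z_def algebra_simps)
    qed (simp add: z_def algebra_simps)
    also have "\<dots> \<in> QP_cycle"
      using less.prems[of k] by (intro convexD[OF convex_QP] IH) auto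
    finally show ?thesis .
  qed
qed

text \<open>Graph points lift to product points, which lie in \<open>QP_cycle\<close>; vertices of
  \<open>QP_cycle\<close> project into the graph.\<close>

lemma graph_hull_eq: "graph_hull (cycle_fun a) = lift_proj a ` QP_cycle"
proof
  have "{(x, z). (\<forall>i. x $ i \<in> {0..1}) \<and> z = cycle_fun a x} \<subseteq> lift_proj a ` QP_cycle"
  proof clarify
    fix x :: "'a idx_vec" assume "\<forall>i. x $ i \<in> {0..1}"
    then have "lift_proj a (x, \<chi> i. x $ i * x $ (i + 1)) \<in> lift_proj a ` QP_cycle"
      by (intro imageI bilinear_point_in_QP) auto
    then show "(x, cycle_fun a x) \<in> lift_proj a ` QP_cycle"
      by (simp add: lift_proj_def cycle_fun_def mult.assoc)
  qed
  then show "graph_hull (cycle_fun a) \<subseteq> lift_proj a ` QP_cycle"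
    unfolding graph_hull_def
    by (intro hull_minimal convex_linear_image linear_lift_proj convex_QP)
next
  have "lift_proj a ` range vertex \<subseteq> {(x, z). (\<forall>i. x $ i \<in> {0..1}) \<and> z = cycle_fun a x}"
    by (auto simp: lift_proj_def cycle_fun_def vertex_def of_bool_conj mult.assoc)
  then show "lift_proj a ` QP_cycle \<subseteq> graph_hull (cycle_fun a)"
    unfolding graph_hull_def QP_cycle_vertices convex_hull_linear_image[OF linear_lift_proj]
    by (rule hull_mono)
qed

text \<open>A cut is even, so it differs from an odd \<open>D\<close> on some edge, and that edge
  alone contributes 1 to the mismatch.\<close>

lemma QP_subset_odd_cycle_poly: "QP_cycle \<subseteq> odd_cycle_poly D"
  unfolding QP_cycle_vertices
proof (rule hull_minimal[of _ _ convex, OF _ convex_odd_cycle_poly], rule image_subsetI)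
  fix X :: "'a mod_ring \<Rightarrow> bool"
  have M: "vertex X \<in> McCormick"
    by (simp add: McCormick_iff edge_prob_vertex)
  have "1 \<le> mismatch D (vertex X)" if "odd (card D)"
  proof -
    have "D \<noteq> {i. X (i + 1) \<noteq> X i}"
      using that even_card_changes[of X] by auto
    then obtain k where k: "(k \<in> D) = (X (k + 1) = X k)" by auto
    let ?f = "\<lambda>i. edge_prob (vertex X) i True (i \<in> D) + edge_prob (vertex X) i False (i \<notin> D)"
    have "1 \<le> ?f k" using k by (auto simp: edge_prob_vertex)
    also have "?f k \<le> mismatch D (vertex X)"
      unfolding mismatch_def
      by (rule member_le_sum) (use M in \<open>auto simp: McCormick_iff\<close>)
    finally show ?thesis .
  qed
  then show "vertex X \<in> odd_cycle_poly D"
    using M by (auto simp: odd_cycle_poly_def mismatch_nonneg)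
qed

lemma QP_subset_McCormick: "QP_cycle \<subseteq> McCormick"
  using QP_subset_odd_cycle_poly by (auto simp: odd_cycle_poly_def)

text \<open>Domination for \<open>a\<close> and for \<open>- a\<close> puts the projected point on a
  vertical segment between two points of a convex set.\<close>

lemma lift_proj_odd_cycle_polys:
  assumes a: "\<forall>i. a i \<noteq> 0"
  shows "lift_proj a ` (odd_cycle_poly (E_neg a) \<inter> odd_cycle_poly (- E_neg a)) = lift_proj a ` QP_cycle"
proof
  show "lift_proj a ` QP_cycle \<subseteq> lift_proj a ` (odd_cycle_poly (E_neg a) \<inter> odd_cycle_poly (- E_neg a))"
    using QP_subset_odd_cycle_poly by blast
  show "lift_proj a ` (odd_cycle_poly (E_neg a) \<inter> odd_cycle_poly (- E_neg a)) \<subseteq> lift_proj a ` QP_cycle"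
  proof (rule image_subsetI)
    fix v assume "v \<in> odd_cycle_poly (E_neg a) \<inter> odd_cycle_poly (- E_neg a)"
    then obtain x y where xy: "v = (x, y)"
        and v: "(x, y) \<in> odd_cycle_poly (E_neg a)" "(x, y) \<in> odd_cycle_poly (- E_neg a)"
      by (cases v) auto
    define s where "s u = (\<Sum>i\<in>UNIV. a i * u $ i)" for u
    have "- E_neg a = {i. - a i < 0}"
      using E_pos_eq[OF a] by (simp add: E_pos_def)
    then obtain y1 y2 where 1: "(x, y1) \<in> QP_cycle" "s y \<le> s y1"
        and 2: "(x, y2) \<in> QP_cycle" "s y2 \<le> s y"
      using odd_cycle_poly_dominated[of "(x, y)" a] odd_cycle_poly_dominated[of "(x, y)" "\<lambda>i. - a i"] v
      by (auto simp: E_neg_def sum_negf s_def)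
    have conv: "convex (lift_proj a ` QP_cycle)"
      by (intro convex_linear_image linear_lift_proj convex_QP)
    have ends: "(x, s y1) \<in> lift_proj a ` QP_cycle" "(x, s y2) \<in> lift_proj a ` QP_cycle"
      using 1(1) 2(1) by (force simp: lift_proj_def s_def)+
    have "s y \<in> closed_segment (s y2) (s y1)"
      using 1(2) 2(2) by (simp add: closed_segment_eq_real_ivl)
    then obtain t where "0 \<le> t" "t \<le> 1" "s y = (1 - t) * s y2 + t * s y1"
      by (auto simp: closed_segment_def)
    then have "(x, s y) \<in> closed_segment (x, s y2) (x, s y1)"
      unfolding closed_segment_def by (intro CollectI exI[of _ t]) (simp flip: scaleR_add_left)
    then have "(x, s y) \<in> lift_proj a ` QP_cycle"
      using closed_segment_subset[OF ends(2,1) conv] by (rule rev_subsetD)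
    then show "lift_proj a v \<in> lift_proj a ` QP_cycle"
      by (simp add: xy lift_proj_def s_def)
  qed
qed

text \<open>As no \<open>b i\<close> is 0, the half point is the only maximiser in its fibre, so
  equality forces \<open>v\<close> to be that point; but its mismatch 0 violates the odd cycle
  inequality.\<close>

lemma lift_half_point_notin:
  assumes b: "\<And>i. b i \<noteq> 0" and D: "D = {i. b i < 0}" and odd: "odd (card D)"
    and v: "v \<in> QP_cycle" "fst v = fst (half_point D)"
  shows "(\<Sum>i\<in>UNIV. b i * snd v $ i) \<noteq> (\<Sum>i\<in>UNIV. b i * snd (half_point D) $ i)"
proof
  assume eq: "(\<Sum>i\<in>UNIV. b i * snd v $ i) = (\<Sum>i\<in>UNIV. b i * snd (half_point D) $ i)"
  have le: "b i * snd v $ i \<le> b i * snd (half_point D) $ i" for i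
    unfolding D using v QP_subset_McCormick
    by (intro half_point_dominates) (auto simp: half_point_def)
  have "b i * snd (half_point D) $ i - b i * snd v $ i = 0" for i
    using sum_nonneg_eq_0_iff[of UNIV "\<lambda>i. b i * snd (half_point D) $ i - b i * snd v $ i"] le eq
    by (simp add: sum_subtractf)
  then have "snd v = snd (half_point D)"
    using b by (simp add: vec_eq_iff)
  then have "v = half_point D"
    using v(2) by (simp add: prod_eq_iff)
  then show False
    using v(1) QP_subset_odd_cycle_poly[of D] odd by (auto simp: odd_cycle_poly_def mismatch_half_point)
qed

lemma lift_proj_half_point_notin:
  assumes a: "\<forall>i. a i \<noteq> 0" and D: "D \<in> {E_neg a, - E_neg a}" and odd: "odd (card D)"
  shows "lift_proj a (half_point D) \<notin> lift_proj a ` QP_cycle"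
proof
  assume "lift_proj a (half_point D) \<in> lift_proj a ` QP_cycle"
  then obtain v where v: "v \<in> QP_cycle" "lift_proj a v = lift_proj a (half_point D)"
    by force
  then have v': "fst v = fst (half_point D)"
      "(\<Sum>i\<in>UNIV. a i * snd v $ i) = (\<Sum>i\<in>UNIV. a i * snd (half_point D) $ i)"
    by (auto simp: lift_proj_def case_prod_beta)
  have "- E_neg a = {i. - a i < 0}"
    using E_pos_eq[OF a] by (simp add: E_pos_def)
  then consider "D = {i. a i < 0}" | "D = {i. - a i < 0}"
    using D by (auto simp: E_neg_def)
  then show False
  proof cases
    case 1
    then show ?thesis using lift_half_point_notin[of a D v] a odd v(1) v' by blast
  next
    case 2
    then show ?thesis using lift_half_point_notin[of "\<lambda>i. - a i" D v] a odd v(1) v' by (simp add: sum_negf)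
  qed
qed

lemma mismatch_half_point_Compl:
  "mismatch (- D) (half_point D) = real CARD('k)" for D :: "'k::nontriv mod_ring set"
  by (simp add: mismatch_def edge_prob_half_point)

text \<open>This is what remains when the inequality of \<open>D\<close> is dropped. For even
  \<open>D\<close> nothing is lost; for odd \<open>D\<close> its half point survives and projects
  outside.\<close>

lemma lift_proj_odd_cycle_poly_Compl_iff:
  assumes a: "\<forall>i. a i \<noteq> 0" and D: "D \<in> {E_neg a, - E_neg a}"
  shows "lift_proj a ` odd_cycle_poly (- D) = lift_proj a ` QP_cycle \<longleftrightarrow> even (card D)"
proof
  assume "even (card D)"
  then have "odd_cycle_poly (- D) = odd_cycle_poly (E_neg a) \<inter> odd_cycle_poly (- E_neg a)"
    using D mismatch_nonneg by (auto simp: odd_cycle_poly_def)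
  then show "lift_proj a ` odd_cycle_poly (- D) = lift_proj a ` QP_cycle"
    using lift_proj_odd_cycle_polys[OF a] by simp
next
  assume eq: "lift_proj a ` odd_cycle_poly (- D) = lift_proj a ` QP_cycle"
  have "half_point D \<in> odd_cycle_poly (- D)"
    using nontriv[where 'a='a]
    by (simp add: odd_cycle_poly_def half_point_in_McCormick mismatch_half_point_Compl)
  then show "even (card D)"
    using lift_proj_half_point_notin[OF a D] eq by blast
qed

subsection \<open>Irredundant systems of inequalities\<close>

text \<open>The strictly feasible point makes \<open>P\<close> full-dimensional, and irredundancy
  makes its facets correspond to the indices. An inequality defining a facet \<open>f i\<close> with
  \<open>i \<noteq> j\<close> stays valid after dropping \<open>j\<close>, so omitting the facet
  \<open>f j\<close> means dropping \<open>j\<close>.\<close>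

lemma omit_facet_irredundant:
  fixes n :: "'i \<Rightarrow> 'v::euclidean_space" and b :: "'i \<Rightarrow> real"
  assumes J: "finite J" and P: "P = {v. \<forall>j\<in>J. n j \<bullet> v \<le> b j}"
    and v0: "\<And>j. j \<in> J \<Longrightarrow> n j \<bullet> v0 < b j"
    and irr: "\<And>j. j \<in> J \<Longrightarrow> \<exists>w. n j \<bullet> w > b j \<and> (\<forall>i\<in>J - {j}. n i \<bullet> w \<le> b i)"
    and facet: "facet_defining P c d"
  shows "\<exists>j\<in>J. omit_facet P c d = {v. \<forall>i\<in>J - {j}. n i \<bullet> v \<le> b i}"
proof -
  define h where "h j = {v. n j \<bullet> v \<le> b j}" for j
  define f where "f j = P \<inter> {v. n j \<bullet> v = b j}" for j
  define g where "g = inv_into J h"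
  have "inj_on h J"
  proof (rule inj_onI)
    fix i j assume ij: "i \<in> J" "j \<in> J" "h i = h j"
    obtain w where "n j \<bullet> w > b j" "\<forall>i\<in>J - {j}. n i \<bullet> w \<le> b i"
      using irr[OF ij(2)] by blast
    then show "i = j"
      using ij unfolding h_def by force
  qed
  then have g: "g (h j) = j" if "j \<in> J" for j
    using that by (simp add: g_def)
  have n0: "n j \<noteq> 0" if "j \<in> J" for j
    using irr[OF that] v0[OF that] by auto
  have v0P: "v0 \<in> P"
    using v0 by (auto simp: P intro: less_imp_le)
  have aff: "affine hull P = UNIV"
  proof (rule affine_hull_nonempty_interior)
    have "open (\<Inter>j\<in>J. {v. n j \<bullet> v < b j})"
      using J by (intro open_INT ballI) (auto intro: open_halfspace_lt)
    moreover have "(\<Inter>j\<in>J. {v. n j \<bullet> v < b j}) \<subseteq> P"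
      by (auto simp: P intro: less_imp_le)
    ultimately have "(\<Inter>j\<in>J. {v. n j \<bullet> v < b j}) \<subseteq> interior P"
      by (simp add: interior_maximal)
    then show "interior P \<noteq> {}"
      using v0 by blast
  qed
  have facets: "C facet_of P \<longleftrightarrow> (\<exists>j\<in>J. C = f j)" for C
  proof -
    have "C facet_of P \<longleftrightarrow>
        (\<exists>H. H \<in> h ` J \<and> C = P \<inter> {v. n (g H) \<bullet> v = b (g H)})"
    proof (rule facet_of_polyhedron_explicit)
      show "finite (h ` J)"
        using J by simp
      show "P = affine hull P \<inter> \<Inter> (h ` J)"
        unfolding aff by (auto simp: P h_def)
      show "n (g H) \<noteq> 0 \<and> H = {x. n (g H) \<bullet> x \<le> b (g H)}" if "H \<in> h ` J" for H
        using that by (auto simp: g n0) (auto simp: h_def)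
      show "P \<subset> affine hull P \<inter> \<Inter> F" if F: "F \<subset> h ` J" for F
      proof -
        obtain j where j: "j \<in> J" "h j \<notin> F" using F by blast
        obtain w where w: "n j \<bullet> w > b j" "\<forall>i\<in>J - {j}. n i \<bullet> w \<le> b i"
          using irr[OF j(1)] by blast
        have "w \<in> \<Inter>F"
        proof
          fix H assume H: "H \<in> F"
          then obtain i where "i \<in> J" "H = h i" using F by blast
          with w j H show "w \<in> H" by (auto simp: h_def)
        qed
        moreover have "w \<notin> P" using w(1) j(1) by (force simp: P)
        moreover have "P \<subseteq> \<Inter>F" using F by (auto simp: P h_def)
        ultimately show ?thesis by (auto simp: aff)
      qed
    qed
    then show ?thesis by (auto simp: g f_def)
  qed
  have point: "\<exists>p\<in>f j. \<forall>i\<in>J - {j}. n i \<bullet> p < b i" if j: "j \<in> J" for j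
  proof -
    obtain w where w: "n j \<bullet> w > b j" "\<forall>i\<in>J - {j}. n i \<bullet> w \<le> b i"
      using irr[OF j] by blast
    \<comment> \<open>The segment from \<open>v0\<close> to \<open>w\<close> meets the hyperplane of
      \<open>j\<close> at \<open>t\<close>; there all other inequalities are strict.\<close>
    define t where "t = (b j - n j \<bullet> v0) / (n j \<bullet> w - n j \<bullet> v0)"
    have t: "0 < t" "t < 1"
      using w(1) v0[OF j] by (auto simp: t_def field_simps)
    define p where "p = (1 - t) *\<^sub>R v0 + t *\<^sub>R w"
    have np: "n i \<bullet> p = (1 - t) * (n i \<bullet> v0) + t * (n i \<bullet> w)" for i
      by (simp add: p_def inner_add_right)
    have "n j \<bullet> p = n j \<bullet> v0 + t * (n j \<bullet> w - n j \<bullet> v0)"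
      by (simp add: np algebra_simps)
    also have "\<dots> = b j"
      using w(1) v0[OF j] by (simp add: t_def)
    finally have 1: "n j \<bullet> p = b j" .
    have 2: "n i \<bullet> p < b i" if "i \<in> J - {j}" for i
    proof -
      have "(1 - t) * (n i \<bullet> v0) < (1 - t) * b i" "t * (n i \<bullet> w) \<le> t * b i"
        using t v0 w(2) that by auto
      then show ?thesis by (simp add: np algebra_simps)
    qed
    have "p \<in> P"
      unfolding P
    proof (intro CollectI ballI)
      fix i assume "i \<in> J"
      then show "n i \<bullet> p \<le> b i"
        using 1 2[of i] by (cases "i = j") auto
    qed
    then show ?thesis
      using 1 2 by (intro bexI[of _ p]) (auto simp: f_def)
  qed
  have f_inj: "f i \<noteq> f j" if "i \<in> J" "j \<in> J" "i \<noteq> j" for i j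
    using point[OF that(1)] that by (force simp: f_def)
  have fd: "facet_defining P (n i) (b i)" if "i \<in> J" for i
  proof -
    have "P \<subseteq> {v. n i \<bullet> v \<le> b i}" using that by (auto simp: P)
    moreover have "f i facet_of P" using that facets by blast
    ultimately show ?thesis by (simp add: facet_defining_def f_def)
  qed
  obtain j where j: "j \<in> J" "P \<inter> {v. c \<bullet> v = d} = f j"
    using facet facets[of "P \<inter> {v. c \<bullet> v = d}"] unfolding facet_defining_def by auto
  have "omit_facet P c d = {v. \<forall>i\<in>J - {j}. n i \<bullet> v \<le> b i}"
  proof (intro equalityI subsetI)
    fix v assume v: "v \<in> omit_facet P c d"
    have "n i \<bullet> v \<le> b i" if i: "i \<in> J - {j}" for i
    proof -
      have "P \<inter> {w. n i \<bullet> w = b i} \<noteq> P \<inter> {w. c \<bullet> w = d}"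
        using f_inj[of i j] i j by (simp add: f_def)
      then show ?thesis
        using v fd[of i] i unfolding omit_facet_def by blast
    qed
    then show "v \<in> {v. \<forall>i\<in>J - {j}. n i \<bullet> v \<le> b i}"
      by simp
  next
    fix v assume v: "v \<in> {v. \<forall>i\<in>J - {j}. n i \<bullet> v \<le> b i}"
    show "v \<in> omit_facet P c d"
      unfolding omit_facet_def aff
    proof (intro CollectI conjI UNIV_I allI impI)
      fix c' d'
      assume A: "facet_defining P c' d' \<and> P \<inter> {w. c' \<bullet> w = d'} \<noteq> P \<inter> {w. c \<bullet> w = d}"
      then obtain i where i: "i \<in> J" "P \<inter> {w. c' \<bullet> w = d'} = f i"
        using facets[of "P \<inter> {w. c' \<bullet> w = d'}"] unfolding facet_defining_def by auto
      have "i \<noteq> j"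
        using A i(2) j(2) by auto
      \<comment> \<open>Strictness at \<open>j\<close> leaves room to move towards \<open>v\<close>,
        which can violate only inequality \<open>j\<close> of the system.\<close>
      obtain w where w: "w \<in> f i" "n j \<bullet> w < b j"
        using point[OF i(1)] j(1) \<open>i \<noteq> j\<close> by blast
      have wP: "w \<in> P" "c' \<bullet> w = d'"
        using w(1) i(2) by auto
      \<comment> \<open>The segment from \<open>w\<close> to \<open>v\<close> starts inside \<open>P\<close>, on the hyperplane of \<open>c'\<close>.\<close>
      show "c' \<bullet> v \<le> d'"
      proof (rule ccontr)
        assume c'v: "\<not> c' \<bullet> v \<le> d'"
        have "((\<lambda>t. (1 - t) * (n j \<bullet> w) + t * (n j \<bullet> v)) \<longlongrightarrow> (1 - 0) * (n j \<bullet> w) + 0 * (n j \<bullet> v)) (at_right 0)"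
          by (intro tendsto_intros)
        then have "\<forall>\<^sub>F t in at_right 0. (1 - t) * (n j \<bullet> w) + t * (n j \<bullet> v) < b j"
          using w(2) by (auto dest: order_tendstoD(2))
        moreover have "\<forall>\<^sub>F t::real in at_right 0. 0 < t \<and> t < 1"
          by (auto simp: eventually_at_right[of 0 1] intro!: exI[of _ 1])
        ultimately obtain t where t: "0 < t" "t < 1" "(1 - t) * (n j \<bullet> w) + t * (n j \<bullet> v) < b j"
          by (metis (mono_tags, lifting) eventually_conj eventually_happens trivial_limit_at_right_real)
        define u where "u = (1 - t) *\<^sub>R w + t *\<^sub>R v"
        have "u \<in> P"
          unfolding P
        proof (intro CollectI ballI)
          fix l assume l: "l \<in> J"
          show "n l \<bullet> u \<le> b l"
          proof (cases "l = j")
            case True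
            then show ?thesis using t(3) by (simp add: u_def inner_add_right)
          next
            case False
            then have "(1 - t) * (n l \<bullet> w) \<le> (1 - t) * b l" "t * (n l \<bullet> v) \<le> t * b l"
              using t v l wP(1) by (auto simp: P)
            then show ?thesis by (simp add: u_def inner_add_right algebra_simps)
          qed
        qed
        then have "c' \<bullet> u \<le> d'"
          using A unfolding facet_defining_def by blast
        moreover have "c' \<bullet> u = d' + t * (c' \<bullet> v - d')"
          by (simp add: u_def inner_add_right wP algebra_simps)
        ultimately show False
          using t(1) c'v by (simp add: mult_le_0_iff)
      qed
    qed
  qed
  then show ?thesis using j(1) by blast
qed

subsection \<open>Minimality\<close>

type_synonym 'k constraint = "('k mod_ring \<times> bool \<times> bool) + 'k mod_ring set"

definition slack :: "'k::nontriv constraint \<Rightarrow> 'k xy_space \<Rightarrow> real" where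
  "slack j v = (case j of Inl (i, p, q) \<Rightarrow> edge_prob v i p q | Inr D \<Rightarrow> mismatch D v - 1)"

text \<open>Only odd edge sets enter, hence the bound 1 in \<open>slack\<close>; the inequality of
  an even set follows from McCormick and would spoil irredundancy.\<close>

definition constraints :: "'k::nontriv mod_ring set \<Rightarrow> 'k constraint set" where
  "constraints N = range Inl \<union> Inr ` {D \<in> {N, - N}. odd (card D)}"

lemma odd_cycle_polys_constraints:
  "odd_cycle_poly N \<inter> odd_cycle_poly (- N) = {v. \<forall>j\<in>constraints N. 0 \<le> slack j v}"
proof -
  have "v \<in> odd_cycle_poly D \<longleftrightarrow> v \<in> McCormick \<and> (odd (card D) \<longrightarrow> 1 \<le> mismatch D v)" for v and D :: "'a mod_ring set"
    by (auto simp: odd_cycle_poly_def mismatch_nonneg)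
  then show ?thesis
    by (auto simp: constraints_def slack_def McCormick_iff ball_Un)
qed

lemma linear_slack: "linear (\<lambda>v. slack j 0 - slack j v)"
proof -
  have e: "linear (\<lambda>v. edge_prob 0 i p q - edge_prob v i p q)" for i :: "'a mod_ring" and p q
    by (cases p; cases q; rule linearI) (auto simp: edge_prob_def algebra_simps)
  have m: "mismatch D 0 - mismatch D v = (\<Sum>i\<in>UNIV. (edge_prob 0 i True (i \<in> D) - edge_prob v i True (i \<in> D))
      + (edge_prob 0 i False (i \<notin> D) - edge_prob v i False (i \<notin> D)))" for D :: "'a mod_ring set" and v
    unfolding mismatch_def sum_subtractf[symmetric] by (intro sum.cong refl) simp
  have "linear (\<lambda>v. mismatch D 0 - mismatch D v)" for D :: "'a mod_ring set"
    unfolding m by (intro linear_compose_sum linear_compose_add e ballI)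
  then show ?thesis
    using e by (cases j) (auto simp: slack_def)
qed

text \<open>Subtracting from the value at 0 makes the affine slack linear; the adjoint at 1 is its
  normal vector. The sign fits the form \<open>n \<bullet> v \<le> slack j 0\<close>.\<close>

lemma slack_inner: "\<exists>n. \<forall>v. n \<bullet> v = slack j 0 - slack j v"
proof
  show "\<forall>v. adjoint (\<lambda>v. slack j 0 - slack j v) 1 \<bullet> v = slack j 0 - slack j v"
    using adjoint_works[OF linear_slack, of _ j 1] by (simp add: inner_commute)
qed

lemma finite_constraints: "finite (constraints N)"
  by (simp add: constraints_def)

lemma polyhedron_constraints: "polyhedron {v. \<forall>j\<in>J. 0 \<le> slack j v}" if "finite J"
proof -
  obtain n where n: "n j \<bullet> v = slack j 0 - slack j v" for j and v :: "'a xy_space"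
    using slack_inner by metis
  have "{v. \<forall>j\<in>J. 0 \<le> slack j v} = (\<Inter>j\<in>J. {v. n j \<bullet> v \<le> slack j 0})"
    using n by auto
  then show ?thesis
    using that by (auto intro!: polyhedron_Inter polyhedron_halfspace_le)
qed

lemma bounded_drop_constraint:
  "bounded {v. \<forall>i\<in>constraints N - {j}. 0 \<le> slack i v}"
proof (rule bounded_subset[OF bounded_xy_box])
  \<comment> \<open>At most one McCormick inequality is missing. If \<open>j\<close> is an odd cycle
    inequality none is, and any triple may be excluded.\<close>
  obtain k p q where j: "range Inl - {Inl (k, p, q)} \<subseteq> constraints N - {j}"
  proof (cases j)
    case (Inl s)
    then show ?thesis using that by (cases s) (auto simp: constraints_def)
  next
    case (Inr D)
    then show ?thesis using that[of undefined undefined undefined] by (auto simp: constraints_def)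
  qed
  show "{v. \<forall>i\<in>constraints N - {j}. 0 \<le> slack i v} \<subseteq> {v. \<forall>i. \<bar>fst v $ i\<bar> \<le> 1 \<and> \<bar>snd v $ i\<bar> \<le> 1}"
  proof (intro subsetI CollectI allI)
    fix v i assume "v \<in> {v. \<forall>i\<in>constraints N - {j}. 0 \<le> slack i v}"
    then have *: "0 \<le> slack (Inl s) v" if "s \<noteq> (k, p, q)" for s
      using j that by blast
    have e: "0 \<le> edge_prob v i p' q'" if "(i, p', q') \<noteq> (k, p, q)" for i p' q'
      using *[OF that] by (simp add: slack_def)
    have x: "0 \<le> fst v $ i \<and> fst v $ i \<le> 1" for i
    proof (cases "i = k")
      case True
      then have "i - 1 \<noteq> k" by auto
      then show ?thesis
        using e[of "i - 1" True True] e[of "i - 1" False True] e[of "i - 1" True False] e[of "i - 1" False False]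
        by (auto simp: edge_prob_def)
    next
      case False
      then show ?thesis
        using e[of i True True] e[of i False True] e[of i True False] e[of i False False]
        by (auto simp: edge_prob_def)
    qed
    \<comment> \<open>One lower and one upper bound on \<open>y i\<close> survive;
      \<open>x k\<close> was bounded through edge \<open>k - 1\<close>.\<close>
    have "0 \<le> edge_prob v i True True \<or> 0 \<le> edge_prob v i False False"
        "0 \<le> edge_prob v i True False \<or> 0 \<le> edge_prob v i False True"
      using e by blast+
    then have "\<bar>snd v $ i\<bar> \<le> 1"
      using x[of i] x[of "i + 1"] by (auto simp: edge_prob_def)
    then show "\<bar>fst v $ i\<bar> \<le> 1 \<and> \<bar>snd v $ i\<bar> \<le> 1"
      using x[of i] by auto
  qed
qed

lemma edge_prob_shift:
  "edge_prob (v + (0, axis k t)) i p q = edge_prob v i p q + (if i = k then if p = q then t else - t else 0)"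
  by (auto simp: edge_prob_def axis_def)

text \<open>
  A vertex whose \<open>k\<close>-th product coordinate is moved across the omitted inequality; the free label of
  \<open>k + 2\<close> makes room for the move in the odd cycle inequality that it affects.
\<close>

lemma drop_McCormick_witness:
  fixes k :: "'k::nontriv mod_ring" and a :: "'k mod_ring \<Rightarrow> real"
  assumes n: "CARD('k) \<ge> 3" and a: "\<forall>i. a i \<noteq> 0"
  shows "\<exists>w. edge_prob w k p q < 0
    \<and> (\<forall>i p' q'. (i, p', q') \<noteq> (k, p, q) \<longrightarrow> 0 \<le> edge_prob w i p' q')
    \<and> (\<forall>D\<in>{N, - N}. 1 \<le> mismatch D w)
    \<and> lift_proj a w \<notin> lift_proj a ` QP_cycle"
proof -
  \<comment> \<open>\<open>E\<close> is the set for which edge \<open>k\<close> contributes 0 after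
    the move; for the other set it contributes 1. The label of \<open>k + 1 + 1\<close> makes edge
    \<open>k + 1\<close> a mismatch for \<open>E\<close>.\<close>
  define E where "E = (if (k \<in> N) = (p = q) then N else - N)"
  define X where "X i = (if i = k then \<not> p else if i = k + 1 then \<not> q
      else i = k + 1 + 1 \<and> ((\<not> q) = (k + 1 \<in> E)))" for i
  have X: "X k = (\<not> p)" "X (k + 1) = (\<not> q)" "X (k + 1 + 1) = ((\<not> q) = (k + 1 \<in> E))"
    using succ_neq_self[of k] succ_neq_self[of "k + 1"] succ_succ_neq_self[OF n, of k]
    by (simp_all only: X_def if_True if_False simp_thms)
  have kE: "(k \<in> E) = (p = q)" by (auto simp: E_def)
  \<comment> \<open>The shift takes the event \<open>(p, q)\<close> of edge \<open>k\<close> from 0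
    to -1/2 and leaves the other three at 1/2.\<close>
  define t :: real where "t = (if p = q then - 1 / 2 else 1 / 2)"
  define w where "w = vertex X + (0, axis k t)"
  have w: "edge_prob w i p' q' = of_bool (X i = p' \<and> X (i + 1) = q')
      + (if i = k then if (p' = q') = (p = q) then - 1 / 2 else 1 / 2 else 0)" for i p' q'
    unfolding w_def edge_prob_shift edge_prob_vertex t_def by auto
  define f where "f D i = edge_prob w i True (i \<in> D) + edge_prob w i False (i \<notin> D)" for D i
  have f_k: "f D k = of_bool (k \<in> D \<longleftrightarrow> p \<noteq> q)" for D
    unfolding f_def w by (cases p; cases q; cases "k \<in> D") (simp_all add: X(1,2))
  have f_other: "f D i = of_bool (X (i + 1) = (X i = (i \<in> D)))" if "i \<noteq> k" for D i
    unfolding f_def w using that by auto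
  have f0: "0 \<le> f D i" for D i
    by (cases "i = k") (auto simp: f_k f_other)
  have "1 \<le> mismatch D w" if D: "D \<in> {N, - N}" for D
  proof -
    have "\<exists>i. f D i = 1"
    proof (cases "k \<in> D \<longleftrightarrow> p \<noteq> q")
      case True
      then show ?thesis using f_k by (intro exI[of _ k]) simp
    next
      case False
      then have "D = E" using kE D by (auto simp: E_def split: if_splits)
      then show ?thesis using f_other[of "k + 1" D] X succ_neq_self by (intro exI[of _ "k + 1"]) auto
    qed
    then obtain i where "f D i = 1" by blast
    moreover have "f D i \<le> sum (f D) UNIV"
      by (rule member_le_sum) (auto simp: f0)
    ultimately show ?thesis
      by (simp add: mismatch_def f_def)
  qed
  moreover have "edge_prob w k p q < 0"
    by (simp add: w X)
  moreover have "0 \<le> edge_prob w i p' q'" if "(i, p', q') \<noteq> (k, p, q)" for i p' q'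
    using that X(1,2) by (cases "i = k") (auto simp: w)
  moreover have "lift_proj a w \<notin> lift_proj a ` QP_cycle"
  proof
    assume "lift_proj a w \<in> lift_proj a ` QP_cycle"
    then obtain v where v: "v \<in> QP_cycle" "lift_proj a v = lift_proj a w" by force
    then have fst_v: "fst v = fst (vertex X)"
        and eq: "(\<Sum>i\<in>UNIV. a i * snd v $ i) = (\<Sum>i\<in>UNIV. a i * snd w $ i)"
      by (auto simp: lift_proj_def case_prod_beta w_def)
    \<comment> \<open>The fibre of \<open>QP_cycle\<close> over a 0/1 vector is a single vertex, so
      the objectives of \<open>v\<close> and \<open>w\<close> differ by
      \<open>a k * t\<close>.\<close>
    have "v = vertex (\<lambda>i. fst v $ i = 1)"
      using v(1) QP_subset_McCormick fst_v by (intro McCormick_integral) (auto simp: vertex_def)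
    then have "v = vertex X"
      using fst_v by (simp add: vertex_def)
    moreover have "(\<Sum>i\<in>UNIV. a i * snd w $ i) = (\<Sum>i\<in>UNIV. a i * snd (vertex X) $ i) + a k * t"
      by (simp add: w_def axis_def distrib_left sum.distrib if_distrib[of "\<lambda>x. _ * x"] cong: if_cong)
    ultimately have "a k * t = 0"
      using eq by simp
    then show False using a by (simp add: t_def split: if_splits)
  qed
  ultimately show ?thesis by blast
qed

text \<open>A shifted vertex violates a given McCormick inequality; the half point of an odd
  \<open>D\<close> violates that of \<open>D\<close>, and has the largest possible mismatch,
  \<open>CARD('k)\<close>, for \<open>- D\<close>.\<close>

lemma drop_constraint_witness:
  fixes a :: "'k::nontriv mod_ring \<Rightarrow> real"
  assumes n: "CARD('k) \<ge> 3" and a: "\<forall>i. a i \<noteq> 0" and j: "j \<in> constraints (E_neg a)"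
  shows "\<exists>w. slack j w < 0 \<and> (\<forall>i\<in>constraints (E_neg a) - {j}. 0 \<le> slack i w)
    \<and> lift_proj a w \<notin> lift_proj a ` QP_cycle"
proof (cases j)
  case (Inl s)
  obtain k p q where s: "s = (k, p, q)" by (cases s)
  obtain w where w: "edge_prob w k p q < 0"
      "\<forall>i p' q'. (i, p', q') \<noteq> (k, p, q) \<longrightarrow> 0 \<le> edge_prob w i p' q'"
      "\<forall>D\<in>{E_neg a, - E_neg a}. 1 \<le> mismatch D w"
      "lift_proj a w \<notin> lift_proj a ` QP_cycle"
    using drop_McCormick_witness[OF n a, of k p q "E_neg a"] by blast
  have "0 \<le> slack i w" if "i \<in> constraints (E_neg a) - {j}" for i
  proof (cases i)
    case i: (Inl s')
    obtain k' p' q' where s': "s' = (k', p', q')" by (cases s')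
    then have "(k', p', q') \<noteq> (k, p, q)"
      using that i Inl s by auto
    then show ?thesis
      using w(2) by (simp add: slack_def i s')
  next
    case i: (Inr D)
    then have "1 \<le> mismatch D w"
      using that by (intro w(3)[rule_format]) (auto simp: constraints_def)
    then show ?thesis
      by (simp add: slack_def i)
  qed
  then show ?thesis
    using w(1,4) by (intro exI[of _ w]) (auto simp: slack_def Inl s)
next
  case (Inr D)
  then have D: "D \<in> {E_neg a, - E_neg a}" "odd (card D)"
    using j by (auto simp: constraints_def)
  have "0 \<le> slack i (half_point D)" if i: "i \<in> constraints (E_neg a) - {j}" for i
  proof (cases i)
    case (Inl s)
    then show ?thesis by (cases s) (simp add: slack_def edge_prob_half_point)
  next
    case (Inr D')
    then have "D' = - D"
      using i D \<open>j = Inr D\<close> by (auto simp: constraints_def)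
    then show ?thesis using n by (simp add: slack_def Inr mismatch_half_point_Compl)
  qed
  then show ?thesis
    using lift_proj_half_point_notin[OF a D]
    by (intro exI[of _ "half_point D"]) (simp add: slack_def Inr mismatch_half_point)
qed

text \<open>For independent uniform labels every event has probability 1/4, and every mismatch is
  half the cycle length, hence above 1.\<close>

lemma constraints_strictly_feasible:
  assumes "CARD('k::nontriv) \<ge> 3"
  shows "\<exists>v :: 'k xy_space. \<forall>j. 0 < slack j v"
proof (intro exI allI)
  let ?v = "(\<chi> i. 1 / 2, \<chi> i. 1 / 4) :: 'k xy_space"
  have e: "edge_prob ?v i p q = 1 / 4" for i p q
    by (simp add: edge_prob_def)
  show "0 < slack j ?v" for j
    using assms by (cases j) (auto simp: slack_def e mismatch_def)
qed

text \<open>Omitting a facet drops one constraint \<open>j\<close>; the witness for \<open>j\<close>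
  then enters and projects outside the hull, while the remaining constraints keep the set
  bounded.\<close>

lemma minimal_extension_odd_cycle_polys:
  fixes a :: "'k::nontriv mod_ring \<Rightarrow> real"
  assumes n: "CARD('k) \<ge> 3" and a: "\<forall>i. a i \<noteq> 0"
  shows "minimal_extension a (odd_cycle_poly (E_neg a) \<inter> odd_cycle_poly (- E_neg a))"
proof -
  define J where "J = constraints (E_neg a)"
  define P where "P = odd_cycle_poly (E_neg a) \<inter> odd_cycle_poly (- E_neg a)"
  have P: "P = {v. \<forall>j\<in>J. 0 \<le> slack j v}"
    unfolding P_def J_def by (rule odd_cycle_polys_constraints)
  have J: "finite J"
    by (simp add: J_def finite_constraints)
  have lift_P: "lift_proj a ` P = graph_hull (cycle_fun a)"
    using lift_proj_odd_cycle_polys[OF a] by (simp add: P_def graph_hull_eq)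
  have "polytope P"
  proof -
    have "bounded P"
      unfolding P_def using compact_odd_cycle_poly by (blast intro: bounded_Int compact_imp_bounded)
    then show ?thesis
      using polyhedron_constraints[OF J] by (simp add: polytope_eq_bounded_polyhedron P)
  qed
  moreover have "QP_cycle \<subseteq> P"
    unfolding P_def using QP_subset_odd_cycle_poly by blast
  ultimately have ext: "extension a P"
    using lift_P by (simp add: extension_def)
  have "polytope (omit_facet P c d) \<and> P \<subset> omit_facet P c d \<and>
      graph_hull (cycle_fun a) \<subset> lift_proj a ` omit_facet P c d"
    if facet: "facet_defining P c d" for c d
  proof -
    obtain m where m_eq: "m j \<bullet> v = slack j 0 - slack j v" for j and v :: "'k xy_space"
      using slack_inner by metis
    have m: "m j \<bullet> v \<le> slack j 0 \<longleftrightarrow> 0 \<le> slack j v"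
      and m_gt: "slack j 0 < m j \<bullet> v \<longleftrightarrow> slack j v < 0" for j and v :: "'k xy_space"
      by (auto simp: m_eq)
    obtain v0 :: "'k xy_space" where v0: "\<And>j. 0 < slack j v0"
      using constraints_strictly_feasible[OF n] by blast
    obtain j where j: "j \<in> J" "omit_facet P c d = {v. \<forall>i\<in>J - {j}. 0 \<le> slack i v}"
    proof -
      have "\<exists>j\<in>J. omit_facet P c d = {v. \<forall>i\<in>J - {j}. m i \<bullet> v \<le> slack i 0}"
      proof (rule omit_facet_irredundant[OF J _ _ _ facet])
        show "P = {v. \<forall>j\<in>J. m j \<bullet> v \<le> slack j 0}"
          by (simp add: P m)
        show "m j \<bullet> v0 < slack j 0" if "j \<in> J" for j
          using v0 by (simp add: m_eq)
        show "\<exists>w. slack j 0 < m j \<bullet> w \<and> (\<forall>i\<in>J - {j}. m i \<bullet> w \<le> slack i 0)" if "j \<in> J" for j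
          using drop_constraint_witness[OF n a, of j] that unfolding J_def m m_gt by blast
      qed
      then show ?thesis
        using that by (auto simp: m)
    qed
    obtain w where w: "slack j w < 0" "\<forall>i\<in>J - {j}. 0 \<le> slack i w"
        "lift_proj a w \<notin> lift_proj a ` QP_cycle"
      using drop_constraint_witness[OF n a, of j] j(1) unfolding J_def by blast
    have "polytope (omit_facet P c d)"
      unfolding j(2) polytope_eq_bounded_polyhedron
      using J bounded_drop_constraint[of "E_neg a" j] by (simp add: J_def polyhedron_constraints)
    moreover have sub: "P \<subseteq> omit_facet P c d" "w \<in> omit_facet P c d"
      unfolding j(2) using w(2) by (auto simp: P)
    moreover have "w \<notin> P"
      using w(1) j(1) by (force simp: P)
    moreover have "graph_hull (cycle_fun a) \<subset> lift_proj a ` omit_facet P c d"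
      using sub w(3) lift_P unfolding graph_hull_eq by blast
    ultimately show ?thesis by blast
  qed
  with ext show ?thesis
    by (simp add: minimal_extension_def P_def)
qed

theorem theorem2:
  fixes a :: "'k::nontriv mod_ring \<Rightarrow> real"
  assumes "CARD('k) \<ge> 3"
    and "\<forall>i. a i \<noteq> 0"
  shows "lift_proj a ` (McCormick \<inter> halfspace_A a \<inter> halfspace_B a) = graph_hull (cycle_fun a)
    \<and> (lift_proj a ` (McCormick \<inter> halfspace_B a) = graph_hull (cycle_fun a)
         \<longleftrightarrow> even (card (E_neg a)))
    \<and> (lift_proj a ` (McCormick \<inter> halfspace_A a) = graph_hull (cycle_fun a)
         \<longleftrightarrow> even (card (E_pos a)))
    \<and> minimal_extension a
         (McCormick \<inter> (if even (card (E_neg a)) then UNIV else halfspace_A a)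
                    \<inter> (if even (card (E_pos a)) then UNIV else halfspace_B a))"
proof -
  define A where "A = odd_cycle_poly (E_neg a)"
  define B where "B = odd_cycle_poly (- E_neg a)"
  have A: "McCormick \<inter> halfspace_A a = A" and B: "McCormick \<inter> halfspace_B a = B"
    unfolding A_def B_def using McCormick_halfspace_A McCormick_halfspace_B assms(2) by auto
  have AB: "A \<inter> halfspace_B a = A \<inter> B"
    using A B by blast
  \<comment> \<open>For an even edge set its inequality holds on all of \<open>McCormick\<close>, so
    the omissions leave the polytope equal to \<open>A \<inter> B\<close>.\<close>
  have even_A: "McCormick = A" if "even (card (E_neg a))"
    using that by (auto simp: A_def odd_cycle_poly_def mismatch_nonneg)
  have even_B: "McCormick = B" if "even (card (E_pos a))"
    using that by (auto simp: B_def odd_cycle_poly_def mismatch_nonneg E_pos_eq[OF assms(2)])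
  have "McCormick \<inter> (if even (card (E_neg a)) then UNIV else halfspace_A a)
      \<inter> (if even (card (E_pos a)) then UNIV else halfspace_B a) = A \<inter> B"
    using A B even_A even_B by auto
  then show ?thesis
    using lift_proj_odd_cycle_polys[OF assms(2)]
      lift_proj_odd_cycle_poly_Compl_iff[OF assms(2), of "E_neg a"]
      lift_proj_odd_cycle_poly_Compl_iff[OF assms(2), of "- E_neg a"]
      minimal_extension_odd_cycle_polys[OF assms]
    by (simp add: A B AB graph_hull_eq E_pos_eq[OF assms(2)] flip: A_def B_def)
qed

end
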